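(* For any $\alpha\in\mathbb{C}$, there exists an admissible Poisson bracket $(\cdot,\cdot)_\alpha$ on the algebra $\mathcal{M}_*^{\leq\infty}=\mathbb{C}[E_2,E_4,E_6]$ of quasimodular forms defined by the following values on the generators: $$(E_4,E_6)_\alpha=-2\Delta,\qquad (E_2,E_4)_\alpha=\alpha E_6E_2,\qquad (E_2,E_6)_\alpha=\frac{3}{2}\alpha E_4^2E_2.$$ Moreover: (i) for any $\alpha\in\mathbb{C}\setminus\{4\}$, the Poisson bracket $(\cdot,\cdot)_\alpha$ is not unimodular. For $\alpha=4$, the Poisson bracket $(\cdot,\cdot)_4$ is Jacobian (hence unimodular) of potential $k_0=-2\Delta E_2$. (ii) The Poisson algebras $(\mathcal{M}_*^{\leq\infty},(\cdot,\cdot)_\alpha)$ and $(\mathcal{M}_*^{\leq\infty},(\cdot,\cdot)_{\alpha'})$ are Poisson modular isomorphic if and only if $\alpha=\alpha'$. (iii) For any $\alpha\in\mathbb{C}$: (a) if $\alpha\notin\mathbb{Q}$, the Poisson center of $(\mathcal{M}_*^{\leq\infty},(\cdot,\cdot)_\alpha)$ is $\mathbb{C}$; (b) if $\alpha=0$, the Poisson center of $(\mathcal{M}_*^{\leq\infty},(\cdot,\cdot)_\alpha)$ is $\mathbb{C}[E_2]$; (c) if $\alpha=p/q$ with $p\in\mathbb{Z}\setminus\{0\}$ and $q\in\mathbb{N}\setminus\{0\}$, $p$ and $q$ coprime, the Poisson center of $(\mathcal{M}_*^{\leq\infty},(\cdot,\cdot)_\alpha)$ is $$\begin{cases}\mathbb{C}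 & \text{if } p<0,\\ \mathbb{C}[\Delta^pE_2^{4q}] & \text{if } p\geq1 \text{ is odd},\\ \mathbb{C}[\Delta^uE_2^{2q}] & \text{if } p=2u \text{ for odd } u\geq1,\\ \mathbb{C}[\Delta^vE_2^{q}] & \text{if } p=4v \text{ with } v\geq1.\end{cases}$$
   Context: Modular forms are for $\mathrm{SL}(2,\mathbb{Z})$. The Eisenstein series are $E_2=1-24\sum_{n\ge1}\sigma_1(n)q^n$, $E_4=1+240\sum_{n\ge1}\sigma_3(n)q^n$, $E_6=1-504\sum_{n\ge1}\sigma_5(n)q^n$, with $q=e^{2\pi i z}$; they are algebraically independent over $\mathbb{C}$. The algebra of modular forms is $\mathcal{M}_*=\mathbb{C}[E_4,E_6]$, and the algebra of quasimodular forms is $\mathcal{M}_*^{\leq\infty}=\mathbb{C}[E_2,E_4,E_6]$, graded by the weight ($E_j$ has weight $j$). $\mathcal{M}_k$ is the space of modular forms of weight $k$ (weight-$k$ part of $\mathcal{M}_*$), and $\mathcal{M}_k^{\leq s}=\bigoplus_{j=0}^s\mathcal{M}_{k-2j}E_2^j$ is the space of quasimodular forms of weight $k$ and depth (degree in $E_2$) at most $s$. $\Delta=E_4^3-E_6^2$. $D=\frac{1}{2\pi i}\frac{d}{dz}$, and $\mathrm{RC}_1$ is the first Rankin-Cohen bracket on $\mathcal{M}_*$, i.e. the bilinear extension of $\mathrm{RC}_1(f,g)=kfD(g)-\ell gD(f)$ for $f\in\mathcal{M}_k$, $g\in\mathcal{M}_\ell$ (so $\mathrm{RC}_1(E_4,E_6)=-2\Delta$).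 A Poisson bracket on a commutative $\mathbb{C}$-algebra is a bilinear skew-symmetric map satisfying the Leibniz rule in each argument and the Jacobi identity. A Poisson bracket $b$ on $\mathcal{M}_*^{\leq\infty}$ is admissible if (1) its restriction to $\mathcal{M}_*$ is $\mathrm{RC}_1$, and (2) $b(\mathcal{M}_k^{\leq s},\mathcal{M}_\ell^{\leq t})\subset\mathcal{M}_{k+\ell+2}^{\leq s+t}$ for all even $k,\ell$ and all integers $s,t\ge 0$. Identify $\mathcal{M}_*^{\leq\infty}$ with $\mathbb{C}[x,y,z]$ via $x=E_2$, $y=E_4$, $z=E_6$. For a Poisson bracket $b$ on $\mathbb{C}[x,y,z]$ put $r=b(x,y)$, $p=b(y,z)$, $q=b(z,x)$ and $\mathrm{curl}(p,q,r)=\left(\frac{\partial r}{\partial y}-\frac{\partial q}{\partial z},\frac{\partial p}{\partial z}-\frac{\partial r}{\partial x},\frac{\partial q}{\partial x}-\frac{\partial p}{\partial y}\right)$. The bracket $b$ is unimodular if there exists $k\in\mathbb{C}[x,y,z]$ with $\mathrm{curl}(p,q,r)=(p,q,r)\wedge\mathrm{grad}\,k$ ($\wedge$ is the cross product). It is Jacobian of potential $k\in\mathbb{C}[x,y,z]$ if $(p,q,r)=\mathrm{grad}\,k$. A Poisson isomorphism (algebra isomorphism intertwining the brackets) $\varphi:(\mathcal{M}_*^{\leq\infty},b_1)\to(\mathcal{M}_*^{\leq\infty},b_2)$ is modular if $\varphi(\mathcal{M}_* )\subset\mathcal{M}_*$; two Poisson structures are Poisson modular isomorphic if such a $\varphi$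 exists. The Poisson center of a Poisson algebra $(A,b)$ is $\{g\in A: b(f,g)=0\ \text{for all } f\in A\}$. *)

theory Defs
  imports "HOL-Complex_Analysis.Complex_Analysis"
begin

definition divisor_sigma :: "nat \<Rightarrow> nat \<Rightarrow> nat" where
  "divisor_sigma k n = (\<Sum>d | d dvd n. d ^ k)"

definition nome :: "complex \<Rightarrow> complex" where
  "nome \<tau> = exp (2 * of_real pi * \<i> * \<tau>)"

definition sigma_series :: "nat \<Rightarrow> complex \<Rightarrow> complex" where
  "sigma_series k \<tau> = (\<Sum>n. of_nat (divisor_sigma k (Suc n)) * nome \<tau> ^ Suc n)"

definition E2_fun :: "complex \<Rightarrow> complex" where
  "E2_fun \<tau> = 1 - 24 * sigma_series 1 \<tau>"

definition E4_fun :: "complex \<Rightarrow> complex" where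
  "E4_fun \<tau> = 1 + 240 * sigma_series 3 \<tau>"

definition E6_fun :: "complex \<Rightarrow> complex" where
  "E6_fun \<tau> = 1 - 504 * sigma_series 5 \<tau>"

definition D :: "(complex \<Rightarrow> complex) \<Rightarrow> complex \<Rightarrow> complex" where
  "D f \<tau> = deriv f \<tau> / (2 * of_real pi * \<i>)"

definition RC1 :: "int \<Rightarrow> int \<Rightarrow> (complex \<Rightarrow> complex) \<Rightarrow> (complex \<Rightarrow> complex) \<Rightarrow> complex \<Rightarrow> complex" where
  "RC1 k l f g \<tau> = of_int k * f \<tau> * D g \<tau> - of_int l * g \<tau> * D f \<tau>"

text \<open>
  Since the Eisenstein series of weights 2, 4, 6 are algebraically independent over the complex
  numbers, the algebra they generate is identified with the polynomial ring in three
  indeterminates, encoded as \<open>((\<complex>[E6])[E4])[E2]\<close>: the outermost indeterminate is \<open>E2\<close>,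
  the innermost one is \<open>E6\<close>. The identification is the evaluation map \<open>qm_fun\<close> below.
\<close>

type_synonym qmod = "complex poly poly poly"

definition scal :: "complex \<Rightarrow> qmod" where
  "scal c = [:[:[:c:]:]:]"

definition E2 :: qmod where "E2 = [:0, 1:]"
definition E4 :: qmod where "E4 = [:[:0, 1:]:]"
definition E6 :: qmod where "E6 = [:[:[:0, 1:]:]:]"

definition Disc :: qmod where
  "Disc = E4 ^ 3 - E6 ^ 2"

definition qm_fun :: "qmod \<Rightarrow> complex \<Rightarrow> complex" where
  "qm_fun P \<tau> = poly (poly (poly P [:[:E2_fun \<tau>:]:]) [:E4_fun \<tau>:]) (E6_fun \<tau>)"

text \<open>The subalgebra \<open>\<complex>[E4, E6]\<close> consists of the polynomials that are constant in \<open>E2\<close>.\<close>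

definition modular_forms :: "qmod set" where
  "modular_forms = range (\<lambda>f. [:f:])"

text \<open>Weights are integers, so that \<open>modular_forms_wt k\<close> is \<open>{0}\<close> for negative \<open>k\<close>.\<close>

definition modular_forms_wt :: "int \<Rightarrow> qmod set" where
  "modular_forms_wt k =
     {[:f:] | f. \<forall>i j. coeff (coeff f i) j \<noteq> 0 \<longrightarrow> 4 * int i + 6 * int j = k}"

definition quasimodular_forms_wt :: "int \<Rightarrow> nat \<Rightarrow> qmod set" where
  "quasimodular_forms_wt k s =
     {(\<Sum>j\<le>s. f j * E2 ^ j) | f. \<forall>j\<le>s. f j \<in> modular_forms_wt (k - 2 * int j)}"

definition poisson_bracket :: "(qmod \<Rightarrow> qmod \<Rightarrow> qmod) \<Rightarrow> bool" where
  "poisson_bracket b \<longleftrightarrow>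
     (\<forall>f g h. b (f + g) h = b f h + b g h) \<and>
     (\<forall>f g h. b f (g + h) = b f g + b f h) \<and>
     (\<forall>c f g. b (scal c * f) g = scal c * b f g) \<and>
     (\<forall>c f g. b f (scal c * g) = scal c * b f g) \<and>
     (\<forall>f g. b f g = - b g f) \<and>
     (\<forall>f g h. b (f * g) h = f * b g h + b f h * g) \<and>
     (\<forall>f g h. b f (g * h) = b f g * h + g * b f h) \<and>
     (\<forall>f g h. b f (b g h) + b g (b h f) + b h (b f g) = 0)"

text \<open>
  As \<open>b\<close> is bilinear and \<open>modular_forms\<close> is the direct sum of its weight spaces, \<open>b\<close> restricts to
  the bilinear extension of the first Rankin-Cohen bracket iff it does so on pairs of
  forms of pure weight.
\<close>

definition restricts_to_RC1 :: "(qmod \<Rightarrow> qmod \<Rightarrow> qmod) \<Rightarrow> bool" where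
  "restricts_to_RC1 b \<longleftrightarrow>
     (\<forall>k l. \<forall>f \<in> modular_forms_wt k. \<forall>g \<in> modular_forms_wt l.
        b f g \<in> modular_forms \<and>
        (\<forall>\<tau>. Im \<tau> > 0 \<longrightarrow> qm_fun (b f g) \<tau> = RC1 k l (qm_fun f) (qm_fun g) \<tau>))"

definition admissible :: "(qmod \<Rightarrow> qmod \<Rightarrow> qmod) \<Rightarrow> bool" where
  "admissible b \<longleftrightarrow>
     poisson_bracket b \<and>
     restricts_to_RC1 b \<and>
     (\<forall>k l s t. even k \<longrightarrow> even l \<longrightarrow>
        (\<forall>f \<in> quasimodular_forms_wt k s. \<forall>g \<in> quasimodular_forms_wt l t.
           b f g \<in> quasimodular_forms_wt (k + l + 2) (s + t)))"

definition d_E2 :: "qmod \<Rightarrow> qmod" where "d_E2 = pderiv"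
definition d_E4 :: "qmod \<Rightarrow> qmod" where "d_E4 = map_poly pderiv"
definition d_E6 :: "qmod \<Rightarrow> qmod" where "d_E6 = map_poly (map_poly pderiv)"

definition grad :: "qmod \<Rightarrow> qmod \<times> qmod \<times> qmod" where
  "grad k = (d_E2 k, d_E4 k, d_E6 k)"

fun curl :: "qmod \<times> qmod \<times> qmod \<Rightarrow> qmod \<times> qmod \<times> qmod" where
  "curl (p, q, r) = (d_E4 r - d_E6 q, d_E6 p - d_E2 r, d_E2 q - d_E4 p)"

fun cross :: "qmod \<times> qmod \<times> qmod \<Rightarrow> qmod \<times> qmod \<times> qmod \<Rightarrow> qmod \<times> qmod \<times> qmod" where
  "cross (a1, a2, a3) (b1, b2, b3) = (a2 * b3 - a3 * b2, a3 * b1 - a1 * b3, a1 * b2 - a2 * b1)"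

definition bracket_vec :: "(qmod \<Rightarrow> qmod \<Rightarrow> qmod) \<Rightarrow> qmod \<times> qmod \<times> qmod" where
  "bracket_vec b = (b E4 E6, b E6 E2, b E2 E4)"

definition unimodular :: "(qmod \<Rightarrow> qmod \<Rightarrow> qmod) \<Rightarrow> bool" where
  "unimodular b \<longleftrightarrow> (\<exists>k. curl (bracket_vec b) = cross (bracket_vec b) (grad k))"

definition jacobian_of_potential :: "(qmod \<Rightarrow> qmod \<Rightarrow> qmod) \<Rightarrow> qmod \<Rightarrow> bool" where
  "jacobian_of_potential b k \<longleftrightarrow> bracket_vec b = grad k"

definition algebra_iso :: "(qmod \<Rightarrow> qmod) \<Rightarrow> bool" where
  "algebra_iso \<phi> \<longleftrightarrow>
     bij \<phi> \<and>
     (\<forall>f g. \<phi> (f + g) = \<phi> f + \<phi> g) \<and>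
     (\<forall>f g. \<phi> (f * g) = \<phi> f * \<phi> g) \<and>
     (\<forall>c. \<phi> (scal c) = scal c)"

definition poisson_iso ::
    "(qmod \<Rightarrow> qmod \<Rightarrow> qmod) \<Rightarrow> (qmod \<Rightarrow> qmod \<Rightarrow> qmod) \<Rightarrow> (qmod \<Rightarrow> qmod) \<Rightarrow> bool" where
  "poisson_iso b1 b2 \<phi> \<longleftrightarrow> algebra_iso \<phi> \<and> (\<forall>f g. \<phi> (b1 f g) = b2 (\<phi> f) (\<phi> g))"

definition poisson_modular_isomorphic ::
    "(qmod \<Rightarrow> qmod \<Rightarrow> qmod) \<Rightarrow> (qmod \<Rightarrow> qmod \<Rightarrow> qmod) \<Rightarrow> bool" where
  "poisson_modular_isomorphic b1 b2 \<longleftrightarrow>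
     (\<exists>\<phi>. poisson_iso b1 b2 \<phi> \<and> \<phi> ` modular_forms \<subseteq> modular_forms)"

definition poisson_center :: "(qmod \<Rightarrow> qmod \<Rightarrow> qmod) \<Rightarrow> qmod set" where
  "poisson_center b = {g. \<forall>f. b f g = 0}"

definition gen_subalgebra :: "qmod \<Rightarrow> qmod set" where
  "gen_subalgebra h = range (\<lambda>P :: complex poly. poly (map_poly scal P) h)"

definition has_generator_values :: "complex \<Rightarrow> (qmod \<Rightarrow> qmod \<Rightarrow> qmod) \<Rightarrow> bool" where
  "has_generator_values \<alpha> b \<longleftrightarrow>
     b E4 E6 = - 2 * Disc \<and>
     b E2 E4 = scal \<alpha> * E6 * E2 \<and>
     b E2 E6 = scal (3 / 2 * \<alpha>) * E4 ^ 2 * E2"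

end

theory Submission
  imports Defs
begin

text \<open>
  Up to the scalar \<open>- 2 Disc\<close> the bracket on modular forms is the Jacobian of a pair of polynomials
  in \<open>E4\<close>, \<open>E6\<close>, and the remaining values say that \<open>E2\<close> is bracketed with a modular form \<open>f\<close> as
  \<open>\<alpha>/2 E2 H(f)\<close>, where \<open>H\<close> is the Hamiltonian derivation of \<open>Disc\<close> for the Jacobian. By Euler's
  identity, agreement with the Rankin-Cohen bracket is equivalent to the single relation
  \<open>4 E4 D(E6) - 6 E6 D(E4) = - 2 Disc\<close> of \<open>q\<close>-series, which follows from the convolution formulas for
  the products of \<open>\<sigma>\<^sub>1\<close> and \<open>\<sigma>\<^sub>3\<close>, of \<open>\<sigma>\<^sub>1\<close> and \<open>\<sigma>\<^sub>5\<close>, and of \<open>\<sigma>\<^sub>3\<close> with itself. These have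
  Skoruppa's combinatorial proof.

  Unimodularity for \<open>\<alpha> \<noteq> 4\<close> is refuted at the point \<open>E2 = 0\<close>, \<open>E4 = E6 = 1\<close>. An element is in the
  centre iff its coefficient \<open>h\<close> of \<open>E2\<^sup>k\<close> satisfies \<open>dh/h = \<alpha>k/4 dDisc/Disc\<close>, so that
  \<open>h\<close> is a multiple of \<open>Disc\<^bsup>\<alpha>k/4\<^esup>\<close> and vanishes unless \<open>\<alpha>k/4\<close> is a natural number. A modular
  isomorphism is affine in \<open>E2\<close>, hence intertwines \<open>\<alpha> H\<close> with \<open>\<alpha>' H\<close>. Comparing weights, it
  rescales \<open>E4\<close> and \<open>E6\<close>, and the relation for \<open>(E4, E6)\<close> forces \<open>\<alpha> = \<alpha>'\<close>.
\<close>

section \<open>Convolution sums of divisor functions\<close>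

text \<open>For the factorisations \<open>a * x\<close> and \<open>b * y\<close> of the two summands
  of \<open>n\<close>, the divisors being summed over are \<open>a\<close> and \<open>b\<close>, and
  their cofactors are \<open>x\<close> and \<open>y\<close>.\<close>

definition sum_of_products :: "nat \<Rightarrow> (nat \<times> nat \<times> nat \<times> nat) set" where
  "sum_of_products n = {(a, b, x, y). 0 < a \<and> 0 < b \<and> 0 < x \<and> 0 < y \<and> a * x + b * y = n}"

lemma finite_sum_of_products [simp]: "finite (sum_of_products n)"
proof (rule finite_subset)
  show "sum_of_products n \<subseteq> {..n} \<times> {..n} \<times> {..n} \<times> {..n}"
  proof (clarsimp simp: sum_of_products_def)
    fix a b x y :: nat assume p: "0 < a" "0 < b" "0 < x" "0 < y"
    have "a \<le> a * x" "b \<le> b * y" "x \<le> a * x" "y \<le> b * y" using p by auto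
    then show "a \<le> a*x + b*y \<and> b \<le> a*x+b*y \<and> x \<le> a*x+b*y \<and> y \<le> a*x+b*y" by linarith
  qed
qed auto

lemma sum_of_products_swap:
  fixes f :: "nat \<Rightarrow> nat \<Rightarrow> nat \<Rightarrow> nat \<Rightarrow> 'a::comm_monoid_add"
  shows "(\<Sum>(a,b,x,y) | (a,b,x,y) \<in> sum_of_products n \<and> P a b x y. f a b x y)
       = (\<Sum>(a,b,x,y) | (a,b,x,y) \<in> sum_of_products n \<and> P b a y x. f b a y x)"
  by (rule sum.reindex_bij_witness[where i = "\<lambda>(a,b,x,y). (b,a,y,x)" and j = "\<lambda>(a,b,x,y). (b,a,y,x)"])
     (auto simp: sum_of_products_def add.commute)

text \<open>Rests on a x + b y = a (x + y) + (b - a) y: subtracting one divisor from the other is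
  compensated by adding the cofactors.\<close>

lemma sum_of_products_shear:
  fixes f :: "nat \<Rightarrow> nat \<Rightarrow> 'a::comm_monoid_add"
  shows "(\<Sum>(a,b,x,y) | (a,b,x,y) \<in> sum_of_products n \<and> a < b. f a b)
       = (\<Sum>(a,b,x,y) | (a,b,x,y) \<in> sum_of_products n \<and> y < x. f a (a + b))"
proof (rule sum.reindex_bij_witness[where i = "\<lambda>(a,b,x,y). (a,a+b,x-y,y)" and j = "\<lambda>(a,b,x,y). (a,b-a,x+y,y)"], goal_cases)
  case (2 t)
  then obtain a b x y where t: "t = (a,b,x,y)" and p: "(a,b,x,y) \<in> sum_of_products n" "a < b" by auto
  then obtain c where "b = a + c" "c > 0" using p(2) by (metis less_imp_add_positive)
  with p show ?case unfolding t by (simp add: sum_of_products_def distrib_left distrib_right)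
next
  case (4 t)
  then obtain a b x y where t: "t = (a,b,x,y)" and p: "(a,b,x,y) \<in> sum_of_products n" "y < x" by auto
  then obtain c where "x = y + c" "c > 0" using p(2) by (metis less_imp_add_positive)
  with p show ?case unfolding t by (simp add: sum_of_products_def distrib_left distrib_right)
qed auto

lemma sum_trichotomy:
  fixes f :: "'b \<Rightarrow> 'a::comm_monoid_add" and u v :: "'b \<Rightarrow> nat"
  assumes "finite S"
  shows "sum f S = sum f {s\<in>S. u s = v s} + (sum f {s\<in>S. u s < v s} + sum f {s\<in>S. v s < u s})"
proof -
  have "S = {s\<in>S. u s = v s} \<union> ({s\<in>S. u s < v s} \<union> {s\<in>S. v s < u s})" by auto
  then have "sum f S = sum f ({s\<in>S. u s = v s} \<union> ({s\<in>S. u s < v s} \<union> {s\<in>S. v s < u s}))" by simp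
  also have "\<dots> = sum f {s\<in>S. u s = v s} + sum f ({s\<in>S. u s < v s} \<union> {s\<in>S. v s < u s})"
    by (rule sum.union_disjoint) (use assms in auto)
  also have "sum f ({s\<in>S. u s < v s} \<union> {s\<in>S. v s < u s}) = sum f {s\<in>S. u s < v s} + sum f {s\<in>S. v s < u s}"
    by (rule sum.union_disjoint) (use assms in auto)
  finally show ?thesis .
qed

lemma sum_of_products_split_divisors:
  fixes f :: "nat \<Rightarrow> nat \<Rightarrow> 'a::comm_monoid_add"
  assumes "\<And>a b. f a b = f b a"
  shows "(\<Sum>(a,b,x,y) \<in> sum_of_products n. f a b)
       = (\<Sum>(a,b,x,y) | (a,b,x,y) \<in> sum_of_products n \<and> a = b. f a b)
       + ((\<Sum>(a,b,x,y) | (a,b,x,y) \<in> sum_of_products n \<and> a < b. f a b)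
       + (\<Sum>(a,b,x,y) | (a,b,x,y) \<in> sum_of_products n \<and> a < b. f a b))"
proof -
  have "(\<Sum>(a,b,x,y) | (a,b,x,y) \<in> sum_of_products n \<and> b < a. f a b)
     = (\<Sum>(a,b,x,y) | (a,b,x,y) \<in> sum_of_products n \<and> a < b. f a b)"
    by (subst sum_of_products_swap) (simp add: assms)
  then show ?thesis
    by (subst sum_trichotomy[where u = fst and v = "fst \<circ> snd"])
       (simp_all add: case_prod_unfold)
qed

lemma sum_of_products_split_cofactors:
  fixes f :: "nat \<Rightarrow> nat \<Rightarrow> 'a::comm_monoid_add"
  assumes "\<And>a b. f a b = f b a"
  shows "(\<Sum>(a,b,x,y) \<in> sum_of_products n. f a b)
       = (\<Sum>(a,b,x,y) | (a,b,x,y) \<in> sum_of_products n \<and> x = y. f a b)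
       + ((\<Sum>(a,b,x,y) | (a,b,x,y) \<in> sum_of_products n \<and> y < x. f a b)
       + (\<Sum>(a,b,x,y) | (a,b,x,y) \<in> sum_of_products n \<and> y < x. f a b))"
proof -
  have "(\<Sum>(a,b,x,y) | (a,b,x,y) \<in> sum_of_products n \<and> x < y. f a b)
     = (\<Sum>(a,b,x,y) | (a,b,x,y) \<in> sum_of_products n \<and> y < x. f a b)"
    by (subst sum_of_products_swap) (simp add: assms)
  then show ?thesis
    by (subst sum_trichotomy[where u = "snd \<circ> snd \<circ> snd" and v = "fst \<circ> snd \<circ> snd"])
       (simp_all add: case_prod_unfold eq_commute)
qed

text \<open>Such a quadruple is a divisor \<open>d\<close> together with a splitting of
  \<open>n div d\<close> into two positive parts, of which there are
  \<open>n div d - 1\<close>.\<close>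

lemma sum_of_products_equal_divisors:
  fixes f :: "nat \<Rightarrow> 'a::semiring_1"
  assumes "n > 0"
  shows "(\<Sum>(a,b,x,y) | (a,b,x,y) \<in> sum_of_products n \<and> a = b. f a)
       = (\<Sum>d | d dvd n. of_nat (n div d - 1) * f d)"
proof -
  have fin: "finite {d. d dvd n}" using assms by (simp add: finite_divisors_nat)
  have "(\<Sum>d | d dvd n. of_nat (n div d - 1) * f d) = (\<Sum>d | d dvd n. \<Sum>x\<in>{1..<n div d}. f d)"
    by simp
  also have "\<dots> = (\<Sum>(d,x)\<in>(SIGMA d:{d. d dvd n}. {1..<n div d}). f d)"
    by (rule sum.Sigma) (use fin in auto)
  also have "\<dots> = (\<Sum>(a,b,x,y) | (a,b,x,y) \<in> sum_of_products n \<and> a = b. f a)"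
  proof (rule sum.reindex_bij_witness[where i = "\<lambda>(a,b,x,y). (a,x)" and j = "\<lambda>(d,x). (d,d,x,n div d - x)"], goal_cases)
    case (2 t)
    then obtain d x where t: "t = (d,x)" and "d dvd n" and x: "1 \<le> x" "x < n div d" by auto
    then obtain k where n: "n = d * k" by (elim dvdE)
    have d: "d > 0" using n assms by (cases d) auto
    then have k: "n div d = k" using n by simp
    with x have "x < k" by simp
    then obtain y where y: "k = x + y" "y > 0" by (metis less_imp_add_positive)
    show ?case unfolding t prod.case k using x d y n by (simp add: sum_of_products_def distrib_left)
  next
    case (3 t)
    then obtain a x y where t: "t = (a,a,x,y)" and a: "a > 0" and "a * x + a * y = n"
      by (auto simp: sum_of_products_def)
    then have "n = a * (x + y)" by (simp only: distrib_left)
    then have "n div a = x + y" using a by simp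
    then show ?case using t by simp
  next
    case (4 t)
    then obtain a x y where t: "t = (a,a,x,y)" and a: "a > 0" "x > 0" "y > 0" and "a * x + a * y = n"
      by (auto simp: sum_of_products_def)
    then have n: "n = a * (x + y)" by (simp only: distrib_left)
    then have "n div a = x + y" using a by simp
    moreover have "a dvd n" using n by (rule dvdI)
    ultimately show ?case using t a by simp
  qed auto
  finally show ?thesis by (rule sym)
qed

text \<open>Equal cofactors give (a + b) x = n, so the quadruple is a divisor d = a + b of
  \<open>n\<close> with a splitting of d into two positive parts.\<close>

lemma sum_of_products_equal_cofactors:
  fixes f :: "nat \<Rightarrow> nat \<Rightarrow> 'a::semiring_1"
  assumes "n > 0"
  shows "(\<Sum>(a,b,x,y) | (a,b,x,y) \<in> sum_of_products n \<and> x = y. f a b)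
       = (\<Sum>d | d dvd n. \<Sum>a\<in>{1..<d}. f a (d - a))"
proof -
  have fin: "finite {d. d dvd n}" using assms by (simp add: finite_divisors_nat)
  have "(\<Sum>d | d dvd n. \<Sum>a\<in>{1..<d}. f a (d - a)) = (\<Sum>(d,a)\<in>(SIGMA d:{d. d dvd n}. {1..<d}). f a (d - a))"
    by (rule sum.Sigma) (use fin in auto)
  also have "\<dots> = (\<Sum>(a,b,x,y) | (a,b,x,y) \<in> sum_of_products n \<and> x = y. f a b)"
  proof (rule sum.reindex_bij_witness[where i = "\<lambda>(a,b,x,y). (a+b,a)" and j = "\<lambda>(d,a). (a,d-a,n div d,n div d)"], goal_cases)
    case (2 t)
    then obtain d a where t: "t = (d,a)" and "d dvd n" and a: "1 \<le> a" "a < d" by auto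
    then obtain k where n: "n = d * k" by (elim dvdE)
    obtain b where b: "d = a + b" "b > 0" using a(2) by (metis less_imp_add_positive)
    have d: "k > 0" using n assms by (cases k) auto
    have k: "n div d = k" using n a by simp
    have "(a, b, k, k) \<in> sum_of_products n"
      using a b d n unfolding sum_of_products_def by (simp add: distrib_right)
    then show ?case unfolding t prod.case k using b by simp
  next
    case (3 t)
    obtain a b x y where t: "t = (a,b,x,y)" by (cases t)
    have p: "a > 0" "a * x + b * y = n" "x = y" using 3 unfolding t sum_of_products_def by blast+
    from p(2) have "n div (a + b) = x" using p(1) unfolding p(3)[symmetric] distrib_right[symmetric] by force
    then show ?case using t p(3) by simp
  next
    case (4 t)
    obtain a b x y where t: "t = (a,b,x,y)" by (cases t)
    have p: "a > 0" "b > 0" "a * x + b * y = n" "x = y" using 4 unfolding t sum_of_products_def by blast+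
    from p(3) have "a + b dvd n" unfolding p(4)[symmetric] distrib_right[symmetric] by (metis dvd_triv_left)
    then show ?case using t p(1,2) by simp
  qed auto
  finally show ?thesis by (rule sym)
qed

text \<open>The tuples with \<open>y < x\<close> for \<open>g\<close> and those with \<open>a < b\<close> for \<open>h\<close> correspond under
  \<open>(a, b, x, y) \<mapsto> (a, a + b, x - y, y)\<close>, so only the diagonals survive. The identity is useful when
  both \<open>h a b\<close> and \<open>h a (a + b)\<close> are symmetric, e.g. for polynomials in \<open>a\<^sup>2 - a b + b\<^sup>2\<close> and
  \<open>(a b (a - b))\<^sup>2\<close>.\<close>

lemma skoruppa_identity:
  fixes h g :: "nat \<Rightarrow> nat \<Rightarrow> 'a::comm_ring_1"
  assumes "n > 0" and h: "\<And>a b. h a b = h b a" and g: "\<And>a b. g a b = g b a"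
    and hg: "\<And>a b. h a (a + b) = g a b"
  shows "(\<Sum>(a,b,x,y) \<in> sum_of_products n. h a b - g a b)
       = (\<Sum>d | d dvd n. of_nat (n div d - 1) * h d d) - (\<Sum>d | d dvd n. \<Sum>a\<in>{1..<d}. g a (d - a))"
proof -
  have "(\<Sum>(a,b,x,y) | (a,b,x,y) \<in> sum_of_products n \<and> a = b. h a b)
      = (\<Sum>(a,b,x,y) | (a,b,x,y) \<in> sum_of_products n \<and> a = b. h a a)"
    by (rule sum.cong) auto
  also have "\<dots> = (\<Sum>d | d dvd n. of_nat (n div d - 1) * h d d)"
    by (rule sum_of_products_equal_divisors[OF assms(1)])
  finally have 1: "(\<Sum>(a,b,x,y) | (a,b,x,y) \<in> sum_of_products n \<and> a = b. h a b) = \<dots>" .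
  have 2: "(\<Sum>(a,b,x,y) | (a,b,x,y) \<in> sum_of_products n \<and> a < b. h a b)
      = (\<Sum>(a,b,x,y) | (a,b,x,y) \<in> sum_of_products n \<and> y < x. g a b)"
    unfolding hg[symmetric] by (rule sum_of_products_shear)
  have "(\<Sum>(a,b,x,y) \<in> sum_of_products n. h a b - g a b)
     = (\<Sum>(a,b,x,y) \<in> sum_of_products n. h a b) - (\<Sum>(a,b,x,y) \<in> sum_of_products n. g a b)"
    by (simp add: case_prod_unfold sum_subtractf)
  then show ?thesis
    unfolding sum_of_products_split_divisors[of h, OF h] sum_of_products_split_cofactors[of g, OF g]
      1 2 sum_of_products_equal_cofactors[OF assms(1)] by (simp only: add_diff_cancel_right)
qed

section \<open>Convolutions as sums over quadruples\<close>

definition sigma_conv :: "nat \<Rightarrow> nat \<Rightarrow> nat \<Rightarrow> nat" where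
  "sigma_conv i j n = (\<Sum>m\<le>n. divisor_sigma i m * divisor_sigma j (n - m))"

text \<open>The divisors of \<open>0\<close> form an infinite set, so the sum defining \<open>divisor_sigma k 0\<close> has the
  value \<open>0\<close> by convention. This makes the \<open>q\<close>-series start at index \<open>0\<close>.\<close>

lemma divisor_sigma_0 [simp]: "divisor_sigma k 0 = 0"
  by (simp add: divisor_sigma_def)

lemma sigma_conv_0 [simp]: "sigma_conv i j 0 = 0"
  by (simp add: sigma_conv_def)

lemma divisor_sigma_pairs:
  assumes "m > 0"
  shows "divisor_sigma k m = (\<Sum>(a,x) | a * x = m. a ^ k)"
proof -
  have "(\<Sum>(a,x)\<in>(\<lambda>d. (d, m div d)) ` {d. d dvd m}. a ^ k) = divisor_sigma k m"
    unfolding divisor_sigma_def by (subst sum.reindex) (auto intro: inj_onI)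
  moreover have "(\<lambda>d. (d, m div d)) ` {d. d dvd m} = {(a,x). a * x = m}"
  proof (rule set_eqI, rule iffI)
    fix t assume "t \<in> (\<lambda>d. (d, m div d)) ` {d. d dvd m}"
    then show "t \<in> {(a,x). a * x = m}" by auto
  next
    fix t assume t: "t \<in> {(a,x). a * x = m}"
    obtain a x where p: "t = (a, x)" by (cases t)
    with t have "m = a * x" by simp
    with assms have "a dvd m" "m div a = x" by (simp, metis nonzero_mult_div_cancel_left mult_0 less_irrefl)
    then show "t \<in> (\<lambda>d. (d, m div d)) ` {d. d dvd m}" unfolding p by blast
  qed
  ultimately show ?thesis by simp
qed

lemma finite_factor_pairs: "m > 0 \<Longrightarrow> finite {(a,x). a * x = (m::nat)}"
  by (rule finite_subset[of _ "{..m} \<times> {..m}"]) (auto simp: Suc_le_eq)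

lemma sigma_conv_eq:
  "sigma_conv i j n = (\<Sum>(a,b,x,y) \<in> sum_of_products n. a ^ i * b ^ j)"
proof -
  let ?F = "\<lambda>m. {(a,x). a * x = m} :: (nat \<times> nat) set"
  let ?S = "SIGMA m:{1..<n}. ?F m \<times> ?F (n - m)"
  \<comment> \<open>The end terms m = 0 and m = n vanish by \<open>divisor_sigma_0\<close>, which
    leaves only splittings of \<open>n\<close> into positive summands.\<close>
  have "sigma_conv i j n = (\<Sum>m\<in>{1..<n}. divisor_sigma i m * divisor_sigma j (n - m))"
    unfolding sigma_conv_def by (rule sum.mono_neutral_right) (auto simp: not_less_eq_eq)
  also have "\<dots> = (\<Sum>m\<in>{1..<n}. \<Sum>(s,t)\<in>?F m \<times> ?F (n - m). fst s ^ i * fst t ^ j)"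
  proof (rule sum.cong)
    fix m assume "m \<in> {1..<n}"
    then have "0 < m" "0 < n - m" by auto
    then show "divisor_sigma i m * divisor_sigma j (n - m) = (\<Sum>(s,t)\<in>?F m \<times> ?F (n - m). fst s ^ i * fst t ^ j)"
      by (simp only: divisor_sigma_pairs sum_product sum.cartesian_product case_prod_unfold)
  qed simp
  also have "\<dots> = (\<Sum>(m,s,t)\<in>?S. fst s ^ i * fst t ^ j)"
    by (rule sum.Sigma) (auto intro!: finite_cartesian_product finite_factor_pairs)
  also have "\<dots> = (\<Sum>(a,b,x,y) \<in> sum_of_products n. a ^ i * b ^ j)"
  proof (rule sum.reindex_bij_witness[where i = "\<lambda>(a,b,x,y). (a*x,(a,x),(b,y))" and j = "\<lambda>(m,(a,x),(b,y)). (a,b,x,y)"], goal_cases)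
    case (1 t)
    obtain m a x b y where t: "t = (m, (a, x), (b, y))" by (metis prod.exhaust)
    from 1 show ?case unfolding t by simp
  next
    case (2 t)
    obtain m a x b y where t: "t = (m, (a, x), (b, y))" by (metis prod.exhaust)
    from 2 have p: "a * x = m" "b * y = n - m" "0 < m" "m < n" unfolding t by simp_all
    then have "0 < a * x" "0 < b * y" by simp_all
    then have "0 < a" "0 < x" "0 < b" "0 < y" by (simp_all only: nat_0_less_mult_iff)
    moreover have "a * x + b * y = n" using p by linarith
    ultimately show ?case unfolding t sum_of_products_def by simp
  next
    case (3 t)
    then show ?case by (cases t) simp
  next
    case (4 t)
    obtain a b x y where t: "t = (a,b,x,y)" by (cases t)
    with 4 have p: "0 < a" "0 < b" "0 < x" "0 < y" "a * x + b * y = n"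
      by (simp_all add: sum_of_products_def)
    then have "0 < a * x" "0 < b * y" by simp_all
    with p(5) have "1 \<le> a * x" "a * x < n" "b * y = n - a * x" by linarith+
    then show ?case unfolding t by simp
  next
    case (5 t)
    obtain m a x b y where t: "t = (m, (a, x), (b, y))" by (metis prod.exhaust)
    show ?case unfolding t by simp
  qed
  finally show ?thesis .
qed

section \<open>Closed forms for the sums over the splittings of a divisor\<close>

lemma sum_powers_upto:
  fixes m :: nat
  defines "M \<equiv> of_nat m :: complex"
  shows "(\<Sum>a=1..m. of_nat a) = M * (M + 1) / 2"
    and "(\<Sum>a=1..m. of_nat a ^ 2) = M * (M + 1) * (2 * M + 1) / 6"
    and "(\<Sum>a=1..m. of_nat a ^ 3) = M ^ 2 * (M + 1) ^ 2 / 4"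
    and "(\<Sum>a=1..m. of_nat a ^ 4) = M * (M + 1) * (2 * M + 1) * (3 * M ^ 2 + 3 * M - 1) / 30"
    and "(\<Sum>a=1..m. of_nat a ^ 5) = M ^ 2 * (M + 1) ^ 2 * (2 * M ^ 2 + 2 * M - 1) / 12"
    and "(\<Sum>a=1..m. of_nat a ^ 6) = M * (M + 1) * (2 * M + 1) * (3 * M ^ 4 + 6 * M ^ 3 - 3 * M + 1) / 42"
  unfolding M_def by (induction m) (auto simp: field_simps power_numeral_reduce)

text \<open>Supplies the equal-cofactor sum for \<open>sigma_conv_1_3\<close>. With b = d - a the
  form a^2 + a b + b^2 becomes a^2 - d a + d^2, so the summand is a quartic polynomial in a.\<close>

lemma sum_squared_quadratic_form:
  assumes "d > 0"
  shows "(\<Sum>a\<in>{1..<d}. (of_nat a ^ 2 + of_nat a * of_nat (d - a) + of_nat (d - a) ^ 2) ^ 2)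
       = (21 * of_nat d ^ 5 - 30 * of_nat d ^ 4 + 10 * of_nat d ^ 3 - of_nat d :: complex) / 30"
proof -
  obtain m where d: "d = Suc m" using assms by (cases d) auto
  let ?D = "of_nat d :: complex"
  have "(\<Sum>a\<in>{1..<d}. (of_nat a ^ 2 + of_nat a * of_nat (d - a) + of_nat (d - a) ^ 2) ^ 2)
      = (\<Sum>a=1..m. of_nat a ^ 4 - 2 * ?D * of_nat a ^ 3 + 3 * ?D ^ 2 * of_nat a ^ 2
            - 2 * ?D ^ 3 * of_nat a + ?D ^ 4)"
  proof (rule sum.cong)
    fix a assume "a \<in> {1..m}"
    then have "of_nat (d - a) = ?D - of_nat a" using d by (intro of_nat_diff) auto
    moreover have "(A ^ 2 + A * (E - A) + (E - A) ^ 2) ^ 2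
       = A ^ 4 - 2 * E * A ^ 3 + 3 * E ^ 2 * A ^ 2 - 2 * E ^ 3 * A + E ^ 4" for A E :: complex
      by algebra
    ultimately show "(of_nat a ^ 2 + of_nat a * of_nat (d - a) + of_nat (d - a) ^ 2) ^ 2
       = of_nat a ^ 4 - 2 * ?D * of_nat a ^ 3 + 3 * ?D ^ 2 * of_nat a ^ 2 - 2 * ?D ^ 3 * of_nat a + ?D ^ 4"
      by (simp only:)
  qed (use d in auto)
  also have "\<dots> = (21 * ?D ^ 5 - 30 * ?D ^ 4 + 10 * ?D ^ 3 - ?D) / 30"
    unfolding sum.distrib sum_subtractf sum_distrib_left[symmetric] sum_powers_upto d
    by (simp add: field_simps power_numeral_reduce)
  finally show ?thesis .
qed

text \<open>The same reduction with a sextic summand, for \<open>sigma_conv_1_5\<close>.\<close>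

lemma sum_cubed_quadratic_form:
  assumes "d > 0"
  shows "(\<Sum>a\<in>{1..<d}. (of_nat a ^ 2 + of_nat a * of_nat (d - a) + of_nat (d - a) ^ 2) ^ 3)
       = (249 * of_nat d ^ 7 - 420 * of_nat d ^ 6 + 210 * of_nat d ^ 5 - 49 * of_nat d ^ 3
          + 10 * of_nat d :: complex) / 420"
proof -
  obtain m where d: "d = Suc m" using assms by (cases d) auto
  let ?D = "of_nat d :: complex"
  let ?p = "\<lambda>a. of_nat a ^ 6 - 3 * ?D * of_nat a ^ 5 + 6 * ?D ^ 2 * of_nat a ^ 4
            - 7 * ?D ^ 3 * of_nat a ^ 3 + 6 * ?D ^ 4 * of_nat a ^ 2 - 3 * ?D ^ 5 * of_nat a + ?D ^ 6"
  have "(\<Sum>a\<in>{1..<d}. (of_nat a ^ 2 + of_nat a * of_nat (d - a) + of_nat (d - a) ^ 2) ^ 3)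
      = (\<Sum>a=1..m. ?p a)"
  proof (rule sum.cong)
    fix a assume "a \<in> {1..m}"
    then have "of_nat (d - a) = ?D - of_nat a" using d by (intro of_nat_diff) auto
    moreover have "(A ^ 2 + A * (E - A) + (E - A) ^ 2) ^ 3
       = A ^ 6 - 3 * E * A ^ 5 + 6 * E ^ 2 * A ^ 4 - 7 * E ^ 3 * A ^ 3 + 6 * E ^ 4 * A ^ 2
         - 3 * E ^ 5 * A + E ^ 6" for A E :: complex
      by algebra
    ultimately show "(of_nat a ^ 2 + of_nat a * of_nat (d - a) + of_nat (d - a) ^ 2) ^ 3 = ?p a"
      by (simp only:)
  qed (use d in auto)
  also have "\<dots> = (249 * ?D ^ 7 - 420 * ?D ^ 6 + 210 * ?D ^ 5 - 49 * ?D ^ 3 + 10 * ?D) / 420"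
    unfolding sum.distrib sum_subtractf sum_distrib_left[symmetric] sum_powers_upto d
    by (simp add: field_simps power_numeral_reduce)
  finally show ?thesis .
qed

text \<open>The equal-cofactor sum for \<open>sigma_conv_3_3\<close>; here a b (a + b) becomes d a
  (d - a).\<close>

lemma sum_squared_cubic_form:
  assumes "d > 0"
  shows "(\<Sum>a\<in>{1..<d}. (of_nat a * of_nat (d - a) * (of_nat a + of_nat (d - a))) ^ 2)
       = (of_nat d ^ 7 - of_nat d ^ 3 :: complex) / 30"
proof -
  obtain m where d: "d = Suc m" using assms by (cases d) auto
  let ?D = "of_nat d :: complex"
  let ?p = "\<lambda>a. ?D ^ 2 * of_nat a ^ 4 - 2 * ?D ^ 3 * of_nat a ^ 3 + ?D ^ 4 * of_nat a ^ 2"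
  have "(\<Sum>a\<in>{1..<d}. (of_nat a * of_nat (d - a) * (of_nat a + of_nat (d - a))) ^ 2)
      = (\<Sum>a=1..m. ?p a)"
  proof (rule sum.cong)
    fix a assume "a \<in> {1..m}"
    then have "of_nat (d - a) = ?D - of_nat a" using d by (intro of_nat_diff) auto
    moreover have "(A * (E - A) * (A + (E - A))) ^ 2
       = E ^ 2 * A ^ 4 - 2 * E ^ 3 * A ^ 3 + E ^ 4 * A ^ 2" for A E :: complex
      by algebra
    ultimately show "(of_nat a * of_nat (d - a) * (of_nat a + of_nat (d - a))) ^ 2 = ?p a"
      by (simp only:)
  qed (use d in auto)
  also have "\<dots> = (?D ^ 7 - ?D ^ 3) / 30"
    unfolding sum.distrib sum_subtractf sum_distrib_left[symmetric] sum_powers_upto d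
    by (simp add: field_simps power_numeral_reduce)
  finally show ?thesis .
qed

lemma sum_divisor_powers:
  "(\<Sum>d | d dvd n. of_nat d ^ k) = (of_nat (divisor_sigma k n) :: complex)"
  by (simp add: divisor_sigma_def)

lemma sum_divisor_cofactor_powers:
  assumes "n > 0"
  shows "(\<Sum>d | d dvd n. of_nat (n div d - 1) * of_nat d ^ Suc k)
       = (of_nat n * of_nat (divisor_sigma k n) - of_nat (divisor_sigma (Suc k) n) :: complex)"
proof -
  have "(\<Sum>d | d dvd n. of_nat (n div d - 1) * of_nat d ^ Suc k)
      = (\<Sum>d | d dvd n. of_nat n * of_nat d ^ k - (of_nat d ^ Suc k :: complex))"
  proof (rule sum.cong)
    fix d assume "d \<in> {d. d dvd n}"
    then obtain e where e: "n = d * e" by (auto elim: dvdE)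
    with assms have "d > 0" "e > 0" by auto
    then show "of_nat (n div d - 1) * of_nat d ^ Suc k = of_nat n * of_nat d ^ k - (of_nat d ^ Suc k :: complex)"
      by (simp add: e of_nat_diff algebra_simps)
  qed simp
  then show ?thesis
    by (simp only: sum_subtractf sum_distrib_left[symmetric] sum_divisor_powers)
qed

lemma of_nat_sigma_conv:
  "of_nat (sigma_conv i j n) = (\<Sum>(a,b,x,y) \<in> sum_of_products n. of_nat a ^ i * of_nat b ^ j :: complex)"
  by (simp add: sigma_conv_eq case_prod_unfold)

lemma sigma_conv_swap: "sigma_conv i j n = sigma_conv j i n"
  unfolding sigma_conv_def
  by (rule sum.reindex_bij_witness[where i = "\<lambda>m. n - m" and j = "\<lambda>m. n - m"]) auto

lemma sum_divisors_cong:
  fixes f :: "nat \<Rightarrow> complex"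
  assumes "\<And>d. d dvd n \<Longrightarrow> f d = g d"
  shows "(\<Sum>d | d dvd n. f d) = (\<Sum>d | d dvd n. g d)"
  using assms by (intro sum.cong) auto

text \<open>The form a^2 - a b + b^2 turns into a^2 + a b + b^2 when b is replaced by a + b, so its
  square is a valid choice of \<open>h\<close>. The difference of the two squares is -4 a b (a^2 +
  b^2), which isolates the wanted convolution and its mirror image.\<close>

theorem sigma_conv_1_3:
  "240 * of_nat (sigma_conv 1 3 n)
   = (21 * of_nat (divisor_sigma 5 n) + (10 - 30 * of_nat n) * of_nat (divisor_sigma 3 n)
      - of_nat (divisor_sigma 1 n) :: complex)"
proof (cases "n = 0")
  case False
  then have n: "n > 0" by simp
  let ?h = "\<lambda>a b :: nat. (of_nat a ^ 2 - of_nat a * of_nat b + of_nat b ^ 2) ^ 2 :: complex"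
  let ?g = "\<lambda>a b :: nat. (of_nat a ^ 2 + of_nat a * of_nat b + of_nat b ^ 2) ^ 2 :: complex"
  have "(\<Sum>(a,b,x,y) \<in> sum_of_products n. ?h a b - ?g a b)
      = (\<Sum>d | d dvd n. of_nat (n div d - 1) * ?h d d) - (\<Sum>d | d dvd n. \<Sum>a\<in>{1..<d}. ?g a (d - a))"
    by (rule skoruppa_identity[OF n]) (simp_all add: algebra_simps power2_eq_square)
  moreover have "?h a b - ?g a b = (- 4) * (of_nat a ^ 1 * of_nat b ^ 3) - 4 * (of_nat a ^ 3 * of_nat b ^ 1)" for a b
    by (simp only: power_one_right) algebra
  moreover have "?h d d = of_nat d ^ Suc 3" for d
    by (simp add: power_numeral_reduce)
  moreover have "(\<Sum>d | d dvd n. \<Sum>a\<in>{1..<d}. ?g a (d - a))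
      = (\<Sum>d | d dvd n. 21/30 * of_nat d ^ 5 - of_nat d ^ 4 + 1/3 * of_nat d ^ 3 - 1/30 * of_nat d ^ 1)"
    using n by (intro sum_divisors_cong, subst sum_squared_quadratic_form) (auto simp: dvd_pos_nat field_simps)
  ultimately have eq: "(- 4) * of_nat (sigma_conv 1 3 n) - 4 * (of_nat (sigma_conv 3 1 n) :: complex)
     = of_nat n * of_nat (divisor_sigma 3 n) - of_nat (divisor_sigma (Suc 3) n)
       - (21/30 * of_nat (divisor_sigma 5 n) - of_nat (divisor_sigma 4 n)
          + 1/3 * of_nat (divisor_sigma 3 n) - 1/30 * of_nat (divisor_sigma 1 n))"
    unfolding of_nat_sigma_conv
    by (simp only: case_prod_unfold sum_subtractf sum.distrib sum_distrib_left[symmetric] sum_divisor_powers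
         sum_divisor_cofactor_powers[OF n])
  have "240 * of_nat (sigma_conv 1 3 n)
    = (- 30) * ((- 4) * of_nat (sigma_conv 1 3 n) - 4 * (of_nat (sigma_conv 3 1 n) :: complex))"
    unfolding sigma_conv_swap[of 3 1] by simp
  then show ?thesis
    unfolding eq by (simp add: algebra_simps)
qed simp

text \<open>Here \<open>h\<close> vanishes for equal divisors, so only the equal-cofactor sum
  remains. In terms of q-series the result is E4^2 = E8, where E8 has the coefficients 480
  sigma_7(n) and constant term 1.\<close>

theorem sigma_conv_3_3:
  "120 * of_nat (sigma_conv 3 3 n) = (of_nat (divisor_sigma 7 n) - of_nat (divisor_sigma 3 n) :: complex)"
proof (cases "n = 0")
  case False
  then have n: "n > 0" by simp
  let ?h = "\<lambda>a b :: nat. (of_nat a * of_nat b * (of_nat a - of_nat b)) ^ 2 :: complex"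
  let ?g = "\<lambda>a b :: nat. (of_nat a * of_nat b * (of_nat a + of_nat b)) ^ 2 :: complex"
  have "(\<Sum>(a,b,x,y) \<in> sum_of_products n. ?h a b - ?g a b)
      = (\<Sum>d | d dvd n. of_nat (n div d - 1) * ?h d d) - (\<Sum>d | d dvd n. \<Sum>a\<in>{1..<d}. ?g a (d - a))"
    by (rule skoruppa_identity[OF n]) (simp_all add: algebra_simps power2_eq_square)
  moreover have "?h a b - ?g a b = (- 4) * (of_nat a ^ 3 * of_nat b ^ 3)" for a b
    by algebra
  moreover have "?h d d = 0" for d
    by simp
  moreover have "(\<Sum>d | d dvd n. \<Sum>a\<in>{1..<d}. ?g a (d - a))
      = (\<Sum>d | d dvd n. 1/30 * of_nat d ^ 7 - 1/30 * of_nat d ^ 3)"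
    using n by (intro sum_divisors_cong, subst sum_squared_cubic_form) (auto simp: dvd_pos_nat field_simps)
  ultimately have "(- 4) * of_nat (sigma_conv 3 3 n)
     = 0 - (1/30 * of_nat (divisor_sigma 7 n) - 1/30 * (of_nat (divisor_sigma 3 n) :: complex))"
    unfolding of_nat_sigma_conv
    by (simp only: case_prod_unfold sum_subtractf sum_distrib_left[symmetric] sum_divisor_powers
         mult_zero_right sum.neutral_const)
  then show ?thesis
    by (simp add: field_simps)
qed simp

text \<open>Cubing the form also produces a^3 b^3, whose convolution \<open>sigma_conv_3_3\<close>
  evaluates.\<close>

theorem sigma_conv_1_5:
  "504 * of_nat (sigma_conv 1 5 n)
   = (20 * of_nat (divisor_sigma 7 n) + (21 - 42 * of_nat n) * of_nat (divisor_sigma 5 n)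
      + of_nat (divisor_sigma 1 n) :: complex)"
proof (cases "n = 0")
  case False
  then have n: "n > 0" by simp
  let ?h = "\<lambda>a b :: nat. (of_nat a ^ 2 - of_nat a * of_nat b + of_nat b ^ 2) ^ 3 :: complex"
  let ?g = "\<lambda>a b :: nat. (of_nat a ^ 2 + of_nat a * of_nat b + of_nat b ^ 2) ^ 3 :: complex"
  have "(\<Sum>(a,b,x,y) \<in> sum_of_products n. ?h a b - ?g a b)
      = (\<Sum>d | d dvd n. of_nat (n div d - 1) * ?h d d) - (\<Sum>d | d dvd n. \<Sum>a\<in>{1..<d}. ?g a (d - a))"
    by (rule skoruppa_identity[OF n]) (simp_all add: algebra_simps power2_eq_square)
  moreover have "?h a b - ?g a b = (- 6) * (of_nat a ^ 1 * of_nat b ^ 5) - 6 * (of_nat a ^ 5 * of_nat b ^ 1)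
     - 14 * (of_nat a ^ 3 * of_nat b ^ 3)" for a b
    by (simp only: power_one_right) algebra
  moreover have "?h d d = of_nat d ^ Suc 5" for d
    by (simp add: power_numeral_reduce)
  moreover have "(\<Sum>d | d dvd n. \<Sum>a\<in>{1..<d}. ?g a (d - a))
      = (\<Sum>d | d dvd n. 249/420 * of_nat d ^ 7 - of_nat d ^ 6 + 1/2 * of_nat d ^ 5
           - 49/420 * of_nat d ^ 3 + 1/42 * of_nat d ^ 1)"
    using n by (intro sum_divisors_cong, subst sum_cubed_quadratic_form) (auto simp: dvd_pos_nat field_simps)
  ultimately have eq: "(- 6) * of_nat (sigma_conv 1 5 n) - 6 * of_nat (sigma_conv 5 1 n)
        - 14 * (of_nat (sigma_conv 3 3 n) :: complex)
     = of_nat n * of_nat (divisor_sigma 5 n) - of_nat (divisor_sigma (Suc 5) n)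
       - (249/420 * of_nat (divisor_sigma 7 n) - of_nat (divisor_sigma 6 n)
          + 1/2 * of_nat (divisor_sigma 5 n) - 49/420 * of_nat (divisor_sigma 3 n)
          + 1/42 * of_nat (divisor_sigma 1 n))"
    unfolding of_nat_sigma_conv
    by (simp only: case_prod_unfold sum_subtractf sum.distrib sum_distrib_left[symmetric] sum_divisor_powers
         sum_divisor_cofactor_powers[OF n])
  \<comment> \<open>The coefficient 49/10 is 14 * 42 / 120, so that the a^3 b^3 term cancels against
    \<open>sigma_conv_3_3\<close>.\<close>
  have "504 * of_nat (sigma_conv 1 5 n)
    = (- 42) * ((- 6) * of_nat (sigma_conv 1 5 n) - 6 * of_nat (sigma_conv 5 1 n)
        - 14 * (of_nat (sigma_conv 3 3 n) :: complex)) - 49 / 10 * (120 * of_nat (sigma_conv 3 3 n))"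
    unfolding sigma_conv_swap[of 5 1] by simp
  then show ?thesis
    unfolding eq sigma_conv_3_3 by (simp add: algebra_simps)
qed simp

section \<open>The Rankin-Cohen bracket of \<open>E4\<close> and \<open>E6\<close>\<close>

definition sigma_powser :: "nat \<Rightarrow> complex \<Rightarrow> complex" where
  "sigma_powser k q = (\<Sum>n. of_nat (divisor_sigma k n) * q ^ n)"

text \<open>The termwise image of \<open>sigma_powser\<close> under q d/dq.\<close>

definition sigma_powser_theta :: "nat \<Rightarrow> complex \<Rightarrow> complex" where
  "sigma_powser_theta k q = (\<Sum>n. of_nat n * of_nat (divisor_sigma k n) * q ^ n)"

lemma divisor_sigma_le: "divisor_sigma k n \<le> n ^ Suc k"
proof (cases "n = 0")
  case False
  then have "(\<Sum>d | d dvd n. d ^ k) \<le> (\<Sum>d\<in>{1..n}. n ^ k)"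
  proof (intro order.trans[OF sum_mono[of _ _ "\<lambda>_. n ^ k"] sum_mono2])
    fix d assume "d \<in> {d. d dvd n}"
    with False show "d ^ k \<le> n ^ k" by (intro power_mono) (auto intro: dvd_imp_le)
  next
    show "{d. d dvd n} \<subseteq> {1..n}"
      using False by (auto intro: dvd_imp_le simp: Suc_le_eq dvd_pos_nat)
  qed auto
  then show ?thesis by (simp add: divisor_sigma_def)
qed simp

text \<open>Induction on \<open>k\<close>: termwise differentiation keeps convergence in the unit
  disc and raises the exponent by one, after a multiplication by x to restore the index.\<close>

lemma summable_powers_times_geometric:
  fixes x :: real
  assumes "norm x < 1"
  shows "summable (\<lambda>n. of_nat n ^ k * x ^ n)"
  using assms
proof (induction k arbitrary: x)
  case 0
  then show ?case by (simp add: summable_geometric)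
next
  case (Suc k)
  have "summable (\<lambda>n. diffs (\<lambda>n. of_nat n ^ k) n * x ^ n)"
    by (rule termdiff_converges[where K = 1]) (use Suc in auto)
  then have "summable (\<lambda>n. diffs (\<lambda>n. of_nat n ^ k) n * x ^ n * x)"
    by (rule summable_mult2)
  then have "summable (\<lambda>n. of_nat (Suc n) ^ Suc k * x ^ Suc n)"
    by (simp add: diffs_def algebra_simps)
  then show ?case
    using summable_Suc_iff[of "\<lambda>n. of_nat n ^ Suc k * x ^ n"] by blast
qed

lemma summable_theta_sigma_norm:
  assumes "norm q < 1"
  shows "summable (\<lambda>n. norm (of_nat n * of_nat (divisor_sigma k n) * q ^ n :: complex))"
proof (rule summable_comparison_test')
  show "summable (\<lambda>n. of_nat n ^ Suc (Suc k) * norm q ^ n :: real)"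
    by (rule summable_powers_times_geometric) (use assms in simp)
next
  fix n :: nat
  have "real (divisor_sigma k n) \<le> real n ^ Suc k"
    using divisor_sigma_le[of k n] by (metis of_nat_le_iff of_nat_power)
  then have "real n * real (divisor_sigma k n) * norm q ^ n \<le> real n * real n ^ Suc k * norm q ^ n"
    by (intro mult_right_mono mult_left_mono) auto
  then show "norm (norm (of_nat n * of_nat (divisor_sigma k n) * q ^ n :: complex)) \<le> of_nat n ^ Suc (Suc k) * norm q ^ n"
    by (simp add: norm_mult norm_power)
qed

lemma summable_sigma_norm:
  assumes "norm q < 1"
  shows "summable (\<lambda>n. norm (of_nat (divisor_sigma k n) * q ^ n :: complex))"
proof (rule summable_comparison_test')
  show "summable (\<lambda>n. norm (of_nat n * of_nat (divisor_sigma k n) * q ^ n :: complex))"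
    by (rule summable_theta_sigma_norm) (rule assms)
next
  fix n :: nat
  show "norm (norm (of_nat (divisor_sigma k n) * q ^ n :: complex)) \<le> norm (of_nat n * of_nat (divisor_sigma k n) * q ^ n)"
  proof (cases "n = 0")
    case False
    then have "1 * norm (of_nat (divisor_sigma k n) * q ^ n) \<le> real n * norm (of_nat (divisor_sigma k n) * q ^ n)"
      by (intro mult_right_mono) auto
    then show ?thesis by (simp add: norm_mult mult.assoc)
  qed simp
qed

lemma sigma_powser_sums:
  assumes "norm q < 1"
  shows "(\<lambda>n. of_nat (divisor_sigma k n) * q ^ n) sums sigma_powser k q"
  unfolding sigma_powser_def by (rule summable_sums[OF summable_norm_cancel[OF summable_sigma_norm[OF assms]]])

lemma sigma_powser_theta_sums:
  assumes "norm q < 1"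
  shows "(\<lambda>n. of_nat n * of_nat (divisor_sigma k n) * q ^ n) sums sigma_powser_theta k q"
  unfolding sigma_powser_theta_def
  by (rule summable_sums[OF summable_norm_cancel[OF summable_theta_sigma_norm[OF assms]]])

lemma sigma_powser_mult_sums:
  assumes "norm q < 1"
  shows "(\<lambda>n. of_nat (sigma_conv i j n) * q ^ n) sums (sigma_powser i q * sigma_powser j q)"
proof -
  have "(\<lambda>n. \<Sum>m\<le>n. (of_nat (divisor_sigma i m) * q ^ m) * (of_nat (divisor_sigma j (n - m)) * q ^ (n - m)))
    sums (sigma_powser i q * sigma_powser j q)"
    unfolding sigma_powser_def by (intro Cauchy_product_sums summable_sigma_norm assms)
  moreover have "(\<Sum>m\<le>n. (of_nat (divisor_sigma i m) * q ^ m) * (of_nat (divisor_sigma j (n - m)) * q ^ (n - m)))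
    = of_nat (sigma_conv i j n) * q ^ n" for n
    unfolding sigma_conv_def of_nat_sum sum_distrib_right
  proof (rule sum.cong)
    fix m assume "m \<in> {..n}"
    then have "q ^ n = q ^ m * q ^ (n - m)" by (simp flip: power_add)
    then show "(of_nat (divisor_sigma i m) * q ^ m) * (of_nat (divisor_sigma j (n - m)) * q ^ (n - m))
       = of_nat (divisor_sigma i m * divisor_sigma j (n - m)) * q ^ n"
      by simp
  qed simp
  ultimately show ?thesis by simp
qed

context
  fixes q :: complex
  assumes q: "norm q < 1"
begin

text \<open>After substituting the q-expansions, this is Ramanujan's formula 3 D(E4) = E2 E4 -
  E6.\<close>

lemma sigma_powser_1_3:
  "240 * (sigma_powser 1 q * sigma_powser 3 q)
     = 21 * sigma_powser 5 q + 10 * sigma_powser 3 q - 30 * sigma_powser_theta 3 q - sigma_powser 1 q"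
proof (rule sums_unique2)
  show "(\<lambda>n. 240 * (of_nat (sigma_conv 1 3 n) * q ^ n)) sums (240 * (sigma_powser 1 q * sigma_powser 3 q))"
    by (intro sums_mult sigma_powser_mult_sums q)
  have "240 * (of_nat (sigma_conv 1 3 n) * q ^ n)
     = 21 * (of_nat (divisor_sigma 5 n) * q ^ n) + 10 * (of_nat (divisor_sigma 3 n) * q ^ n)
       - 30 * (of_nat n * of_nat (divisor_sigma 3 n) * q ^ n) - of_nat (divisor_sigma 1 n) * q ^ n" for n
    unfolding mult.assoc[symmetric] sigma_conv_1_3 by (simp add: algebra_simps)
  then show "(\<lambda>n. 240 * (of_nat (sigma_conv 1 3 n) * q ^ n))
    sums (21 * sigma_powser 5 q + 10 * sigma_powser 3 q - 30 * sigma_powser_theta 3 q - sigma_powser 1 q)"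
    by (simp only:) (intro sums_add sums_diff sums_mult sigma_powser_sums sigma_powser_theta_sums q)
qed

text \<open>Together with \<open>sigma_powser_3_3\<close>, which replaces E8 by E4^2, this is
  Ramanujan's formula 2 D(E6) = E2 E6 - E4^2.\<close>

lemma sigma_powser_1_5:
  "504 * (sigma_powser 1 q * sigma_powser 5 q)
     = 20 * sigma_powser 7 q + 21 * sigma_powser 5 q - 42 * sigma_powser_theta 5 q + sigma_powser 1 q"
proof (rule sums_unique2)
  show "(\<lambda>n. 504 * (of_nat (sigma_conv 1 5 n) * q ^ n)) sums (504 * (sigma_powser 1 q * sigma_powser 5 q))"
    by (intro sums_mult sigma_powser_mult_sums q)
  have "504 * (of_nat (sigma_conv 1 5 n) * q ^ n)
     = 20 * (of_nat (divisor_sigma 7 n) * q ^ n) + 21 * (of_nat (divisor_sigma 5 n) * q ^ n)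
       - 42 * (of_nat n * of_nat (divisor_sigma 5 n) * q ^ n) + of_nat (divisor_sigma 1 n) * q ^ n" for n
    unfolding mult.assoc[symmetric] sigma_conv_1_5 by (simp add: algebra_simps)
  then show "(\<lambda>n. 504 * (of_nat (sigma_conv 1 5 n) * q ^ n))
    sums (20 * sigma_powser 7 q + 21 * sigma_powser 5 q - 42 * sigma_powser_theta 5 q + sigma_powser 1 q)"
    by (simp only:) (intro sums_add sums_diff sums_mult sigma_powser_sums sigma_powser_theta_sums q)
qed

lemma sigma_powser_3_3:
  "120 * (sigma_powser 3 q * sigma_powser 3 q) = sigma_powser 7 q - sigma_powser 3 q"
proof (rule sums_unique2)
  show "(\<lambda>n. 120 * (of_nat (sigma_conv 3 3 n) * q ^ n)) sums (120 * (sigma_powser 3 q * sigma_powser 3 q))"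
    by (intro sums_mult sigma_powser_mult_sums q)
  have "120 * (of_nat (sigma_conv 3 3 n) * q ^ n)
     = of_nat (divisor_sigma 7 n) * q ^ n - of_nat (divisor_sigma 3 n) * q ^ n" for n
    unfolding mult.assoc[symmetric] sigma_conv_3_3 by (simp add: algebra_simps)
  then show "(\<lambda>n. 120 * (of_nat (sigma_conv 3 3 n) * q ^ n)) sums (sigma_powser 7 q - sigma_powser 3 q)"
    by (simp only:) (intro sums_diff sigma_powser_sums q)
qed

lemma sigma_powser_deriv:
  "\<exists>d. (sigma_powser k has_field_derivative d) (at q) \<and> q * d = sigma_powser_theta k q"
proof -
  \<comment> \<open>The radius r gives a point of convergence beyond |q|, as termwise
    differentiation at q requires.\<close>
  obtain r where r: "norm q < r" "r < 1" using q dense by blast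
  have r0: "0 < r" using le_less_trans[OF norm_ge_zero r(1)] .
  let ?c = "\<lambda>n. of_nat (divisor_sigma k n) :: complex"
  have "summable (\<lambda>n. ?c n * of_real r ^ n)"
    by (rule summable_norm_cancel, rule summable_sigma_norm) (use r r0 in simp)
  then have "((\<lambda>x. \<Sum>n. ?c n * x ^ n) has_field_derivative (\<Sum>n. diffs ?c n * q ^ n)) (at q)"
    by (rule termdiffs_strong) (use r r0 in simp)
  moreover have "sigma_powser k = (\<lambda>x. \<Sum>n. ?c n * x ^ n)"
    by (simp add: sigma_powser_def fun_eq_iff)
  moreover have "q * (\<Sum>n. diffs ?c n * q ^ n) = sigma_powser_theta k q"
  proof (rule sums_unique2)
    have "summable (\<lambda>n. diffs ?c n * q ^ n)"
      by (rule termdiff_converges[where K = 1])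
         (use q in \<open>simp_all add: summable_norm_cancel[OF summable_sigma_norm]\<close>)
    then have "(\<lambda>n. of_nat n * ?c n * q ^ (n - Suc 0)) sums (\<Sum>n. diffs ?c n * q ^ n)"
      by (rule diffs_equiv)
    then have "(\<lambda>n. q * (of_nat n * ?c n * q ^ (n - Suc 0))) sums (q * (\<Sum>n. diffs ?c n * q ^ n))"
      by (rule sums_mult)
    moreover have "q * (of_nat n * ?c n * q ^ (n - Suc 0)) = of_nat n * ?c n * q ^ n" for n
      by (cases n) simp_all
    ultimately show "(\<lambda>n. of_nat n * ?c n * q ^ n) sums (q * (\<Sum>n. diffs ?c n * q ^ n))"
      by simp
  qed (rule sigma_powser_theta_sums[OF q])
  ultimately show ?thesis by auto
qed

end

section \<open>From q-series to functions on the upper half-plane\<close>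

lemma norm_nome_less_1: "Im \<tau> > 0 \<Longrightarrow> norm (nome \<tau>) < 1"
  by (simp add: nome_def)

text \<open>\<open>sigma_series\<close> starts at exponent 1 and \<open>sigma_powser\<close> at 0,
  where the coefficient is 0 by \<open>divisor_sigma_0\<close>.\<close>

lemma sigma_series_eq:
  assumes "Im \<tau> > 0"
  shows "sigma_series k \<tau> = sigma_powser k (nome \<tau>)"
  using suminf_split_head[OF sums_summable[OF sigma_powser_sums[OF norm_nome_less_1[OF assms], of k]]]
  by (simp add: sigma_series_def sigma_powser_def)

lemma sigma_series_has_derivative:
  assumes "Im \<tau> > 0"
  shows "(sigma_series k has_field_derivative 2 * of_real pi * \<i> * sigma_powser_theta k (nome \<tau>)) (at \<tau>)"
proof -
  obtain d where d: "(sigma_powser k has_field_derivative d) (at (nome \<tau>))"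
      "nome \<tau> * d = sigma_powser_theta k (nome \<tau>)"
    using sigma_powser_deriv[OF norm_nome_less_1[OF assms]] by blast
  have "(nome has_field_derivative 2 * of_real pi * \<i> * nome \<tau>) (at \<tau>)"
    unfolding nome_def[abs_def] by (auto intro!: derivative_eq_intros)
  from DERIV_chain2[OF d(1) this]
  have "((\<lambda>t. sigma_powser k (nome t)) has_field_derivative 2 * of_real pi * \<i> * sigma_powser_theta k (nome \<tau>)) (at \<tau>)"
    by (simp add: d(2)[symmetric] mult_ac)
  then show ?thesis
  proof (rule has_field_derivative_transform_within_open)
    show "open {t. Im t > 0}" by (rule open_halfspace_Im_gt)
  qed (use assms in \<open>simp_all add: sigma_series_eq\<close>)
qed

lemma E4_fun_has_derivative:
  assumes "Im \<tau> > 0"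
  shows "(E4_fun has_field_derivative 240 * (2 * of_real pi * \<i> * sigma_powser_theta 3 (nome \<tau>))) (at \<tau>)"
  using DERIV_add[OF DERIV_const[of 1] DERIV_cmult[OF sigma_series_has_derivative[OF assms, of 3], of 240]]
  by (simp add: E4_fun_def[abs_def])

lemma E6_fun_has_derivative:
  assumes "Im \<tau> > 0"
  shows "(E6_fun has_field_derivative - (504 * (2 * of_real pi * \<i> * sigma_powser_theta 5 (nome \<tau>)))) (at \<tau>)"
  using DERIV_diff[OF DERIV_const[of 1] DERIV_cmult[OF sigma_series_has_derivative[OF assms, of 5], of 504]]
  by (simp add: E6_fun_def[abs_def])

lemma D_E4_fun: "Im \<tau> > 0 \<Longrightarrow> D E4_fun \<tau> = 240 * sigma_powser_theta 3 (nome \<tau>)"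
  by (simp add: D_def DERIV_imp_deriv[OF E4_fun_has_derivative])

lemma D_E6_fun: "Im \<tau> > 0 \<Longrightarrow> D E6_fun \<tau> = - 504 * sigma_powser_theta 5 (nome \<tau>)"
  by (simp add: D_def DERIV_imp_deriv[OF E6_fun_has_derivative])

theorem RC1_E4_E6:
  assumes "Im \<tau> > 0"
  shows "4 * E4_fun \<tau> * D E6_fun \<tau> - 6 * E6_fun \<tau> * D E4_fun \<tau> = - 2 * (E4_fun \<tau> ^ 3 - E6_fun \<tau> ^ 2)"
proof -
  define q where "q = nome \<tau>"
  have q: "norm q < 1" unfolding q_def by (rule norm_nome_less_1[OF assms])
  have E: "E2_fun \<tau> = 1 - 24 * sigma_powser 1 q" "E4_fun \<tau> = 1 + 240 * sigma_powser 3 q"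
    "E6_fun \<tau> = 1 - 504 * sigma_powser 5 q"
    using sigma_series_eq[OF assms] by (simp_all add: E2_fun_def E4_fun_def E6_fun_def q_def)
  have D4: "3 * D E4_fun \<tau> = E2_fun \<tau> * E4_fun \<tau> - E6_fun \<tau>"
    using sigma_powser_1_3[OF q] unfolding D_E4_fun[OF assms] E q_def[symmetric] by algebra
  have D6: "2 * D E6_fun \<tau> = E2_fun \<tau> * E6_fun \<tau> - E4_fun \<tau> ^ 2"
    using sigma_powser_1_5[OF q] sigma_powser_3_3[OF q]
    unfolding D_E6_fun[OF assms] E q_def[symmetric] by algebra
  \<comment> \<open>Eliminating the derivatives leaves E2 E4 E6 twice with opposite signs.\<close>
  show ?thesis using D4 D6 by algebra
qed

section \<open>The Poisson brackets\<close>

lemma sum_additive: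
  fixes d :: "'a::comm_monoid_add \<Rightarrow> 'b::comm_monoid_add"
  assumes "d 0 = 0" "\<And>a b. d (a + b) = d a + d b"
  shows "d (\<Sum>i\<in>A. f i) = (\<Sum>i\<in>A. d (f i))"
  by (induction A rule: infinite_finite_induct) (simp_all add: assms)

lemma map_poly_additive:
  assumes "d 0 = 0" "\<And>a b. d (a + b) = d a + d b"
  shows "map_poly d (p + q) = map_poly d p + map_poly d q"
  by (rule poly_eqI) (simp add: coeff_map_poly assms)

lemma map_poly_Leibniz:
  fixes d :: "'a::comm_ring_1 \<Rightarrow> 'a"
  assumes "d 0 = 0" "\<And>a b. d (a + b) = d a + d b" "\<And>a b. d (a * b) = a * d b + d a * b"
  shows "map_poly d (p * q) = p * map_poly d q + map_poly d p * q"
  by (rule poly_eqI)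
     (simp add: coeff_map_poly coeff_mult assms(1) sum_additive[OF assms(1,2)] assms(3) sum.distrib)

text \<open>\<open>pderiv\<close> acts on coefficients by shifting and by multiplying with naturals,
  both compatible with an additive map. Used for the symmetry of mixed partial derivatives.\<close>

lemma pderiv_map_poly_commute:
  fixes d :: "'a::{comm_semiring_1,semiring_no_zero_divisors} \<Rightarrow> 'a"
  assumes "d 0 = 0" "\<And>a b. d (a + b) = d a + d b"
  shows "pderiv (map_poly d p) = map_poly d (pderiv p)"
proof (rule poly_eqI)
  fix n
  have "d (of_nat k * c) = of_nat k * d c" for k c
    by (induction k) (simp_all add: assms distrib_right)
  then show "coeff (pderiv (map_poly d p)) n = coeff (map_poly d (pderiv p)) n"
    by (simp add: coeff_map_poly assms(1) coeff_pderiv del: of_nat_Suc)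
qed

lemma coeff_d_E2: "coeff (d_E2 f) n = of_nat (Suc n) * coeff f (Suc n)"
  by (simp add: d_E2_def coeff_pderiv del: of_nat_Suc)

lemma coeff_d_E4: "coeff (d_E4 f) n = pderiv (coeff f n)"
  by (simp add: d_E4_def coeff_map_poly)

lemma coeff_d_E6: "coeff (d_E6 f) n = map_poly pderiv (coeff f n)"
  by (simp add: d_E6_def coeff_map_poly)

lemma map_poly_pderiv_Leibniz:
  "map_poly pderiv (p * q) = p * map_poly pderiv q + map_poly pderiv p * (q :: complex poly poly)"
  by (rule map_poly_Leibniz) (simp_all add: pderiv_add pderiv_mult mult.commute)

lemma map_poly_pderiv_add:
  "map_poly pderiv (p + q) = map_poly pderiv p + map_poly pderiv (q :: complex poly poly)"
  by (rule map_poly_additive) (simp_all add: pderiv_add)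

lemma d_add [simp]:
  "d_E2 (f + g) = d_E2 f + d_E2 g" "d_E4 (f + g) = d_E4 f + d_E4 g" "d_E6 (f + g) = d_E6 f + d_E6 g"
  by (simp_all add: d_E2_def d_E4_def d_E6_def pderiv_add map_poly_additive map_poly_pderiv_add)

lemma d_mult [simp]:
  "d_E2 (f * g) = f * d_E2 g + d_E2 f * g"
  "d_E4 (f * g) = f * d_E4 g + d_E4 f * g"
  "d_E6 (f * g) = f * d_E6 g + d_E6 f * g"
proof -
  show "d_E2 (f * g) = f * d_E2 g + d_E2 f * g"
    by (simp add: d_E2_def pderiv_mult mult.commute)
  show "d_E4 (f * g) = f * d_E4 g + d_E4 f * g"
    unfolding d_E4_def by (rule map_poly_Leibniz) (simp_all add: pderiv_add pderiv_mult mult.commute)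
  show "d_E6 (f * g) = f * d_E6 g + d_E6 f * g"
    unfolding d_E6_def
    by (rule map_poly_Leibniz) (simp_all add: map_poly_pderiv_add map_poly_pderiv_Leibniz)
qed

lemma d_scal [simp]: "d_E2 (scal c) = 0" "d_E4 (scal c) = 0" "d_E6 (scal c) = 0"
  by (simp_all add: d_E2_def d_E4_def d_E6_def scal_def pderiv_pCons map_poly_pCons)

lemma d_gen [simp]:
  "d_E2 E2 = 1" "d_E4 E2 = 0" "d_E6 E2 = 0"
  "d_E2 E4 = 0" "d_E4 E4 = 1" "d_E6 E4 = 0"
  "d_E2 E6 = 0" "d_E4 E6 = 0" "d_E6 E6 = 1"
  by (simp_all add: d_E2_def d_E4_def d_E6_def E2_def E4_def E6_def pderiv_pCons map_poly_pCons
        one_pCons)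

lemma d_commute:
  "d_E2 (d_E4 f) = d_E4 (d_E2 f)" "d_E2 (d_E6 f) = d_E6 (d_E2 f)" "d_E4 (d_E6 f) = d_E6 (d_E4 f)"
proof -
  show "d_E2 (d_E4 f) = d_E4 (d_E2 f)"
    unfolding d_E2_def d_E4_def by (rule pderiv_map_poly_commute) (simp_all add: pderiv_add)
  show "d_E2 (d_E6 f) = d_E6 (d_E2 f)"
    unfolding d_E2_def d_E6_def by (rule pderiv_map_poly_commute) (simp_all add: map_poly_pderiv_add)
  have "pderiv (map_poly pderiv p) = map_poly pderiv (pderiv p)" for p :: "complex poly poly"
    by (rule pderiv_map_poly_commute) (simp_all add: pderiv_add)
  then show "d_E4 (d_E6 f) = d_E6 (d_E4 f)"
    by (intro poly_eqI) (simp add: coeff_d_E4 coeff_d_E6)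
qed

lemma scal_simps:
  "scal 0 = 0" "scal 1 = 1" "scal (a + b) = scal a + scal b" "scal (a * b) = scal a * scal b"
  "scal (- a) = - scal a" "scal (a - b) = scal a - scal b"
  by (simp_all add: scal_def one_pCons)

lemma scal_numeral: "scal (numeral n) = numeral n"
  by (simp add: scal_def numeral_poly)

lemma d_const [simp]:
  "d_E2 0 = 0" "d_E4 0 = 0" "d_E6 0 = 0" "d_E2 1 = 0" "d_E4 1 = 0" "d_E6 1 = 0"
  "d_E2 (numeral n) = 0" "d_E4 (numeral n) = 0" "d_E6 (numeral n) = 0"
  using d_scal[of 0] d_scal[of 1] d_scal[of "numeral n"] unfolding scal_simps scal_numeral by simp_all

lemma d_minus [simp]:
  "d_E2 (- f) = - d_E2 f" "d_E4 (- f) = - d_E4 f" "d_E6 (- f) = - d_E6 f"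
  using d_add[of f "- f"] by (simp_all del: d_add add: add_eq_0_iff[symmetric])

lemma d_diff [simp]:
  "d_E2 (f - g) = d_E2 f - d_E2 g" "d_E4 (f - g) = d_E4 f - d_E4 g" "d_E6 (f - g) = d_E6 f - d_E6 g"
  using d_add[of f "- g"] by simp_all

lemma d_Disc [simp]: "d_E2 Disc = 0" "d_E4 Disc = 3 * E4 ^ 2" "d_E6 Disc = - 2 * E6"
  by (simp_all add: Disc_def power2_eq_square power3_eq_cube algebra_simps)

text \<open>Induction over the algebra generated by scalars and the three variables, the form suited
  to derivations and homomorphisms. Obtained by Horner decomposition in \<open>E6\<close>, then
  \<open>E4\<close>, then \<open>E2\<close>.\<close>

lemma qmod_induct [case_names scal E2 E4 E6 add mult]:
  assumes "\<And>c. P (scal c)" "P E2" "P E4" "P E6"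
    and add: "\<And>f g. P f \<Longrightarrow> P g \<Longrightarrow> P (f + g)" and mult: "\<And>f g. P f \<Longrightarrow> P g \<Longrightarrow> P (f * g)"
  shows "P f"
proof -
  have 1: "P [:[:h:]:]" for h
  proof (induction h)
    case 0
    show ?case using assms(1)[of 0] by (simp add: scal_def)
  next
    case (pCons c h)
    have "[:[:pCons c h:]:] = scal c + E6 * [:[:h:]:]" by (simp add: scal_def E6_def)
    then show ?case using add[OF assms(1) mult[OF assms(4) pCons(2)]] by simp
  qed
  have 2: "P [:h:]" for h
  proof (induction h)
    case 0
    show ?case using assms(1)[of 0] by (simp add: scal_def)
  next
    case (pCons c h)
    have "[:pCons c h:] = [:[:c:]:] + E4 * [:h:]" by (simp add: E4_def)
    then show ?case using add[OF 1 mult[OF assms(3) pCons(2)]] by simp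
  qed
  show ?thesis
  proof (induction f)
    case 0
    show ?case using assms(1)[of 0] by (simp add: scal_def)
  next
    case (pCons c h)
    have "pCons c h = [:c:] + E2 * h" by (simp add: E2_def)
    then show ?case using add[OF 2 mult[OF assms(2) pCons(2)]] by simp
  qed
qed

section \<open>A closed form for the bracket\<close>

definition modular_jacobian :: "qmod \<Rightarrow> qmod \<Rightarrow> qmod" where
  "modular_jacobian f g = d_E4 f * d_E6 g - d_E6 f * d_E4 g"

text \<open>This is \<open>modular_jacobian Disc f\<close> written out, so that \<open>Disc\<close>
  is annihilated.\<close>

definition ham_Disc :: "qmod \<Rightarrow> qmod" where
  "ham_Disc f = 2 * E6 * d_E4 f + 3 * E4 ^ 2 * d_E6 f"

text \<open>The biderivation extending the values on generators; a formula for all pairs makes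
  bilinearity, skew-symmetry and the Leibniz rules direct computations.\<close>

definition br :: "complex \<Rightarrow> qmod \<Rightarrow> qmod \<Rightarrow> qmod" where
  "br \<alpha> f g = - 2 * Disc * modular_jacobian f g
     + scal (\<alpha> / 2) * E2 * (d_E2 f * ham_Disc g - ham_Disc f * d_E2 g)"

text \<open>Expanding by the product rule leaves a polynomial identity in the first and second
  derivatives of the arguments, in which mixed derivatives are identified by
  \<open>d_commute\<close>.\<close>

lemma br_jacobi: "br \<alpha> f (br \<alpha> g h) + br \<alpha> g (br \<alpha> h f) + br \<alpha> h (br \<alpha> f g) = 0"
proof -
  show ?thesis
    unfolding br_def modular_jacobian_def ham_Disc_def
    by (simp add: d_commute power2_eq_square) algebra
qed

lemma poisson_bracket_br: "poisson_bracket (br \<alpha>)"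
  unfolding poisson_bracket_def
proof (intro conjI allI)
  fix f g h
  show "br \<alpha> f (br \<alpha> g h) + br \<alpha> g (br \<alpha> h f) + br \<alpha> h (br \<alpha> f g) = 0" by (rule br_jacobi)
qed (simp_all add: br_def modular_jacobian_def ham_Disc_def algebra_simps)

lemma scal_half: "scal \<alpha> = 2 * scal (\<alpha> / 2)" "scal (3 / 2 * \<alpha>) = 3 * scal (\<alpha> / 2)"
  unfolding scal_numeral[symmetric] scal_simps(4)[symmetric] by simp_all

lemma has_generator_values_br: "has_generator_values \<alpha> (br \<alpha>)"
  unfolding has_generator_values_def scal_half(1)[of \<alpha>] scal_half(2)[of \<alpha>]
  by (simp add: br_def modular_jacobian_def ham_Disc_def)

text \<open>By the Leibniz rule a bracket is determined by its values on pairs of generators, and by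
  skew-symmetry three of these suffice.\<close>

lemma poisson_bracket_unique:
  assumes b: "poisson_bracket b" "has_generator_values \<alpha> b"
    and b': "poisson_bracket b'" "has_generator_values \<alpha> b'"
  shows "b = b'"
proof -
  have skew: "\<forall>f g. p f g = - p g f" and self: "p f f = 0" and const: "p (scal c) g = 0"
    and add: "p (f + g) h = p f h + p g h" and mult: "p (f * g) h = f * p g h + p f h * g"
    if p: "poisson_bracket p" for p c f g h
  proof -
    from p show sk: "\<forall>f g. p f g = - p g f"
      unfolding poisson_bracket_def by (elim conjE) assumption
    have "p f f + p f f = 0"
      by (rule eq_neg_iff_add_eq_0[THEN iffD1], rule sk[rule_format])
    then have "2 * p f f = 0" by (simp only: mult_2)
    then show "p f f = 0" by simp
    from p have ad: "\<forall>f g h. p (f + g) h = p f h + p g h"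
      unfolding poisson_bracket_def by (elim conjE) assumption
    then show "p (f + g) h = p f h + p g h" by simp
    from p have mu: "\<forall>f g h. p (f * g) h = f * p g h + p f h * g"
      unfolding poisson_bracket_def by (elim conjE) assumption
    then show "p (f * g) h = f * p g h + p f h * g" by simp
    from p have "\<forall>c f g. p (scal c * f) g = scal c * p f g"
      unfolding poisson_bracket_def by (elim conjE) assumption
    then have "p (scal c * 1) g = scal c * p 1 g" by iprover
    \<comment> \<open>The Leibniz rule for 1 = 1 * 1 gives p 1 g = 0, and linearity extends this to
      all scalars.\<close>
    moreover have "p (1 * 1) g = 1 * p 1 g + p 1 g * 1" by (rule mu[rule_format])
    ultimately show "p (scal c) g = 0" by simp
  qed
  have gen_ext: "b f g = b' f g" if "b E2 g = b' E2 g" "b E4 g = b' E4 g" "b E6 g = b' E6 g" for f g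
    by (induction f rule: qmod_induct)
       (simp_all add: that const[OF b(1)] const[OF b'(1)] add[OF b(1)] add[OF b'(1)] mult[OF b(1)] mult[OF b'(1)])
  have swap: "b g f = b' g f" if "b f g = b' f g" for f g
  proof -
    have "b g f = - b f g" by (rule skew[OF b(1), rule_format])
    also have "\<dots> = - b' f g" by (simp only: that)
    also have "\<dots> = b' g f" by (rule skew[OF b'(1), rule_format, symmetric])
    finally show ?thesis .
  qed
  have gens: "b E4 E6 = b' E4 E6" "b E2 E4 = b' E2 E4" "b E2 E6 = b' E2 E6"
    using b(2) b'(2) by (simp_all add: has_generator_values_def)
  note gens' = gens[THEN swap]
  have "b f E2 = b' f E2" "b f E4 = b' f E4" "b f E6 = b' f E6" for f
    by (rule gen_ext, (simp only: gens gens' self[OF b(1)] self[OF b'(1)])+)+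
  then have "b f g = b' f g" for f g
    by (rule gen_ext[OF swap swap swap])
  then show "b = b'" by (simp add: fun_eq_iff)
qed

section \<open>The Jacobian case and the obstruction to unimodularity\<close>

lemma bracket_vec_br:
  "bracket_vec (br \<alpha>) = (- 2 * Disc, - 3 * scal (\<alpha> / 2) * E4 ^ 2 * E2, 2 * scal (\<alpha> / 2) * E6 * E2)"
  by (simp add: bracket_vec_def br_def modular_jacobian_def ham_Disc_def)

lemma jacobian_of_potential_br_4: "jacobian_of_potential (br 4) (- 2 * Disc * E2)"
  by (simp add: jacobian_of_potential_def bracket_vec_br grad_def scal_numeral algebra_simps)

lemma unimodular_br_4: "unimodular (br 4)"
  unfolding unimodular_def bracket_vec_br
  \<comment> \<open>The bracket vector is a gradient, so its curl is 0 and k = 0 is a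
    witness.\<close>
  by (rule exI[of _ 0]) (simp add: grad_def scal_numeral power2_eq_square algebra_simps)

lemma not_unimodular_br:
  assumes "\<alpha> \<noteq> 4"
  shows "\<not> unimodular (br \<alpha>)"
proof
  define ev where "ev f = poly (poly (poly f 0) 1) 1" for f :: qmod
  assume "unimodular (br \<alpha>)"
  then obtain k where "curl (bracket_vec (br \<alpha>)) = cross (bracket_vec (br \<alpha>)) (grad k)"
    by (auto simp: unimodular_def)
  \<comment> \<open>The second component of the vector equation. Each term on its right-hand side
    has a factor \<open>E2\<close> or \<open>Disc\<close>, and both vanish at the evaluation point,
    whatever \<open>k\<close> is; the left-hand side becomes 4 - \<alpha>.\<close>
  then have "4 * E6 - 2 * scal (\<alpha> / 2) * E6
      = 2 * scal (\<alpha> / 2) * E6 * E2 * d_E2 k + 2 * Disc * d_E6 k"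
    by (simp add: bracket_vec_br grad_def)
  then have "ev (4 * E6 - 2 * scal (\<alpha> / 2) * E6)
      = ev (2 * scal (\<alpha> / 2) * E6 * E2 * d_E2 k + 2 * Disc * d_E6 k)"
    by (rule arg_cong)
  moreover have "ev E6 = 1" "ev E2 = 0" "ev Disc = 0" "ev (scal (\<alpha> / 2)) = \<alpha> / 2"
    by (simp_all add: ev_def E6_def E2_def E4_def scal_def Disc_def)
  moreover have "ev (f * g) = ev f * ev g" "ev (f - g) = ev f - ev g" "ev (f + g) = ev f + ev g"
     "ev (numeral n) = numeral n" for f g n
    by (simp_all add: ev_def)
  ultimately have "4 - \<alpha> = 0" by simp
  with assms show False by simp
qed

section \<open>Weight and depth\<close>

abbreviation qcoeff :: "qmod \<Rightarrow> nat \<Rightarrow> nat \<Rightarrow> nat \<Rightarrow> complex" where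
  "qcoeff f a i j \<equiv> coeff (coeff (coeff f a) i) j"

lemma coeff_of_nat_mult: "coeff (of_nat k * p) i = of_nat k * coeff p i"
  by (induction k) (simp_all add: distrib_right)

lemma qcoeff_d:
  "qcoeff (d_E2 f) a i j = of_nat (Suc a) * qcoeff f (Suc a) i j"
  "qcoeff (d_E4 f) a i j = of_nat (Suc i) * qcoeff f a (Suc i) j"
  "qcoeff (d_E6 f) a i j = of_nat (Suc j) * qcoeff f a i (Suc j)"
  by (simp_all only: coeff_d_E2 coeff_d_E4 coeff_d_E6 coeff_pderiv coeff_of_nat_mult coeff_map_poly pderiv_0)

lemma sum_nonzeroE:
  assumes "(\<Sum>x\<in>A. f x) \<noteq> 0"
  obtains x where "x \<in> A" "f x \<noteq> 0"
  using assms sum.neutral[of A f] by blast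

lemma qcoeff_mult_nonzero:
  assumes "qcoeff (f * g) a i j \<noteq> 0"
  shows "\<exists>a1 a2 i1 i2 j1 j2. a = a1 + a2 \<and> i = i1 + i2 \<and> j = j1 + j2 \<and>
           qcoeff f a1 i1 j1 \<noteq> 0 \<and> qcoeff g a2 i2 j2 \<noteq> 0"
proof -
  have "(\<Sum>a1\<le>a. \<Sum>i1\<le>i. \<Sum>j1\<le>j. qcoeff f a1 i1 j1 * qcoeff g (a - a1) (i - i1) (j - j1)) \<noteq> 0"
    using assms by (simp add: coeff_mult coeff_sum)
  then obtain a1 where a1: "a1 \<le> a"
    and "(\<Sum>i1\<le>i. \<Sum>j1\<le>j. qcoeff f a1 i1 j1 * qcoeff g (a - a1) (i - i1) (j - j1)) \<noteq> 0"
    by (rule sum_nonzeroE) simp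
  from this(2) obtain i1 where i1: "i1 \<le> i"
    and "(\<Sum>j1\<le>j. qcoeff f a1 i1 j1 * qcoeff g (a - a1) (i - i1) (j - j1)) \<noteq> 0"
    by (rule sum_nonzeroE) simp
  from this(2) obtain j1 where j1: "j1 \<le> j"
    and "qcoeff f a1 i1 j1 * qcoeff g (a - a1) (i - i1) (j - j1) \<noteq> 0"
    by (rule sum_nonzeroE) simp
  then have nz: "qcoeff f a1 i1 j1 \<noteq> 0" "qcoeff g (a - a1) (i - i1) (j - j1) \<noteq> 0"
    by simp_all
  have "a = a1 + (a - a1)" "i = i1 + (i - i1)" "j = j1 + (j - j1)"
    using a1 i1 j1 by simp_all
  with nz show ?thesis by blast
qed

lemma qmod_eqI: "(\<And>a i j. qcoeff f a i j = qcoeff g a i j) \<Longrightarrow> f = g"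
  by (intro poly_eqI)

lemma qcoeff_scal_mult: "qcoeff (scal c * f) a i j = c * qcoeff f a i j"
  by (simp add: scal_def)

lemma coeff_E2_power_mult: "coeff (E2 ^ n * f) a = (if a < n then 0 else coeff f (a - n))"
proof -
  have "E2 ^ n = monom 1 n" by (simp add: E2_def monom_altdef)
  then show ?thesis by (simp add: coeff_monom_mult)
qed

lemma coeff_const_E2_power: "coeff ([:h:] * E2 ^ n) a = (if a = n then h else 0)"
proof -
  have "[:h:] * E2 ^ n = monom h n" by (simp add: E2_def monom_altdef)
  then show ?thesis by simp
qed

lemma qcoeff_gen_mult:
  "qcoeff (E4 * f) a i j = (case i of 0 \<Rightarrow> 0 | Suc i' \<Rightarrow> qcoeff f a i' j)"
  "qcoeff (E6 * f) a i j = (case j of 0 \<Rightarrow> 0 | Suc j' \<Rightarrow> qcoeff f a i j')"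
  by (simp_all add: E4_def E6_def coeff_pCons split: nat.splits)

text \<open>Membership in \<open>quasimodular_forms_wt\<close> as a condition on the support, which
  passes through products and derivatives monomial by monomial.\<close>

definition homog :: "int \<Rightarrow> nat \<Rightarrow> qmod \<Rightarrow> bool" where
  "homog k s f \<longleftrightarrow> (\<forall>a i j. qcoeff f a i j \<noteq> 0 \<longrightarrow> 2 * int a + 4 * int i + 6 * int j = k \<and> a \<le> s)"

lemma quasimodular_forms_wt_iff: "f \<in> quasimodular_forms_wt k s \<longleftrightarrow> homog k s f"
proof
  assume "f \<in> quasimodular_forms_wt k s"
  then obtain g where f: "f = (\<Sum>j\<le>s. g j * E2 ^ j)" and g: "\<forall>j\<le>s. g j \<in> modular_forms_wt (k - 2 * int j)"
    by (auto simp: quasimodular_forms_wt_def)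
  show "homog k s f"
    unfolding homog_def
  proof (intro allI impI)
    fix a i j assume "qcoeff f a i j \<noteq> 0"
    then have "(\<Sum>n\<le>s. qcoeff (g n * E2 ^ n) a i j) \<noteq> 0"
      by (simp add: f coeff_sum)
    then obtain n where n: "n \<le> s" "qcoeff (g n * E2 ^ n) a i j \<noteq> 0"
      by (rule sum_nonzeroE) simp
    obtain h where h: "g n = [:h:]" "\<forall>i j. coeff (coeff h i) j \<noteq> 0 \<longrightarrow> 4 * int i + 6 * int j = k - 2 * int n"
      using g n(1) by (auto simp: modular_forms_wt_def)
    have "a = n" "coeff (coeff h i) j \<noteq> 0"
      using n(2) unfolding h(1) coeff_const_E2_power by (auto split: if_splits)
    then show "2 * int a + 4 * int i + 6 * int j = k \<and> a \<le> s"
      using n(1) h(2) by force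
  qed
next
  assume f: "homog k s f"
  have "f = (\<Sum>j\<le>s. [:coeff f j:] * E2 ^ j)"
  proof (rule poly_eqI)
    fix n
    have "coeff (\<Sum>j\<le>s. [:coeff f j:] * E2 ^ j) n = (\<Sum>j\<le>s. if j = n then coeff f n else 0)"
      unfolding coeff_sum
      unfolding coeff_const_E2_power by (rule sum.cong) auto
    also have "\<dots> = coeff f n"
    proof (cases "n \<le> s")
      case False
      then have "coeff f n = 0" using f by (intro poly_eqI) (auto simp: homog_def)
      then show ?thesis by simp
    qed simp
    finally show "coeff f n = coeff (\<Sum>j\<le>s. [:coeff f j:] * E2 ^ j) n" ..
  qed
  moreover have "[:coeff f j:] \<in> modular_forms_wt (k - 2 * int j)" for j
    using f by (force simp: modular_forms_wt_def homog_def)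
  ultimately show "f \<in> quasimodular_forms_wt k s"
    unfolding quasimodular_forms_wt_def mem_Collect_eq
    by (intro exI[of _ "\<lambda>j. [:coeff f j:]"] conjI allI impI)
qed

lemma homog_add:
  assumes "homog k s f" "homog k s g"
  shows "homog k s (f + g)"
  unfolding homog_def
proof (intro allI impI)
  fix a i j assume "qcoeff (f + g) a i j \<noteq> 0"
  then have "qcoeff f a i j \<noteq> 0 \<or> qcoeff g a i j \<noteq> 0" by auto
  then show "2 * int a + 4 * int i + 6 * int j = k \<and> a \<le> s"
    using assms unfolding homog_def by blast
qed

lemma homog_uminus: "homog k s f \<Longrightarrow> homog k s (- f)"
  by (simp add: homog_def)

lemma homog_diff: "homog k s f \<Longrightarrow> homog k s g \<Longrightarrow> homog k s (f - g)"
  using homog_add[OF _ homog_uminus, of k s f g] by simp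

lemma homog_mult:
  assumes "homog k s f" "homog l t g"
  shows "homog (k + l) (s + t) (f * g)"
  unfolding homog_def
proof (intro allI impI)
  fix a i j assume "qcoeff (f * g) a i j \<noteq> 0"
  then obtain a1 a2 i1 i2 j1 j2 where *: "a = a1 + a2" "i = i1 + i2" "j = j1 + j2"
    "qcoeff f a1 i1 j1 \<noteq> 0" "qcoeff g a2 i2 j2 \<noteq> 0"
    using qcoeff_mult_nonzero by blast
  then have "2 * int a1 + 4 * int i1 + 6 * int j1 = k \<and> a1 \<le> s"
    "2 * int a2 + 4 * int i2 + 6 * int j2 = l \<and> a2 \<le> t"
    using assms unfolding homog_def by blast+
  then show "2 * int a + 4 * int i + 6 * int j = k + l \<and> a \<le> s + t"
    using *(1-3) by simp
qed

lemma homog_d_E4: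
  assumes "homog k s f"
  shows "homog (k - 4) s (d_E4 f)"
  unfolding homog_def qcoeff_d
proof (intro allI impI)
  fix a i j assume "of_nat (Suc i) * qcoeff f a (Suc i) j \<noteq> 0"
  then have "2 * int a + 4 * int (Suc i) + 6 * int j = k \<and> a \<le> s"
    using assms[unfolded homog_def, rule_format, of a "Suc i" j] by simp
  then show "2 * int a + 4 * int i + 6 * int j = k - 4 \<and> a \<le> s" by simp
qed

lemma homog_d_E6:
  assumes "homog k s f"
  shows "homog (k - 6) s (d_E6 f)"
  unfolding homog_def qcoeff_d
proof (intro allI impI)
  fix a i j assume "of_nat (Suc j) * qcoeff f a i (Suc j) \<noteq> 0"
  then have "2 * int a + 4 * int i + 6 * int (Suc j) = k \<and> a \<le> s"
    using assms[unfolded homog_def, rule_format, of a i "Suc j"] by simp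
  then show "2 * int a + 4 * int i + 6 * int j = k - 6 \<and> a \<le> s" by simp
qed

text \<open>The derivative is taken together with the factor \<open>E2\<close>, so that weight and
  depth are both preserved; in \<open>br\<close> every \<open>d_E2\<close> comes with such a
  factor.\<close>

lemma homog_E2_d_E2: "homog k s f \<Longrightarrow> homog k s (E2 * d_E2 f)"
  unfolding homog_def
proof (intro allI impI)
  fix a i j
  assume f: "\<forall>a i j. qcoeff f a i j \<noteq> 0 \<longrightarrow> 2 * int a + 4 * int i + 6 * int j = k \<and> a \<le> s"
    and "qcoeff (E2 * d_E2 f) a i j \<noteq> 0"
  then obtain b where "a = Suc b" "qcoeff (d_E2 f) b i j \<noteq> 0"
    using coeff_E2_power_mult[of 1 "d_E2 f" a] by (cases a) auto
  then show "2 * int a + 4 * int i + 6 * int j = k \<and> a \<le> s"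
    using f[rule_format, of "Suc b" i j] unfolding qcoeff_d by simp
qed

lemma homog_scal: "homog 0 0 (scal c)"
  by (auto simp: homog_def scal_def coeff_pCons split: nat.splits)

lemma homog_numeral: "homog 0 0 (numeral n)"
  using homog_scal[of "numeral n"] by (simp add: scal_numeral)

lemma homog_gen: "homog 4 0 E4" "homog 6 0 E6"
  by (auto simp: homog_def E4_def E6_def coeff_pCons one_pCons split: nat.splits)

lemma homog_Disc: "homog 12 0 Disc"
proof -
  have "homog 12 0 (E4 ^ 3)"
    using homog_mult[OF homog_mult[OF homog_gen(1) homog_gen(1)] homog_gen(1)]
    by (simp add: power3_eq_cube)
  moreover have "homog 12 0 (E6 ^ 2)"
    using homog_mult[OF homog_gen(2) homog_gen(2)] by (simp add: power2_eq_square)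
  ultimately show ?thesis unfolding Disc_def by (rule homog_diff)
qed

lemma homog_ham_Disc:
  assumes "homog k s f"
  shows "homog (k + 2) s (ham_Disc f)"
proof -
  have "homog (0 + 6 + (k - 4)) (0 + 0 + s) (2 * E6 * d_E4 f)"
    by (intro homog_mult homog_numeral homog_gen homog_d_E4 assms)
  moreover have "homog (0 + (4 + 4) + (k - 6)) (0 + (0 + 0) + s) (3 * E4 ^ 2 * d_E6 f)"
    unfolding power2_eq_square by (intro homog_mult homog_numeral homog_gen homog_d_E6 assms)
  ultimately show ?thesis
    unfolding ham_Disc_def by (intro homog_add) (simp_all add: algebra_simps)
qed

lemma homog_br:
  assumes f: "homog k s f" and g: "homog l t g"
  shows "homog (k + l + 2) (s + t) (br \<alpha> f g)"
proof -
  have jac: "br \<alpha> f g = - (2 * Disc * (d_E4 f * d_E6 g)) + 2 * Disc * (d_E6 f * d_E4 g)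
     + (scal (\<alpha> / 2) * ((E2 * d_E2 f) * ham_Disc g) - scal (\<alpha> / 2) * (ham_Disc f * (E2 * d_E2 g)))"
    by (simp add: br_def modular_jacobian_def algebra_simps)
  have "homog (0 + 12 + ((k - 4) + (l - 6))) (0 + 0 + (s + t)) (2 * Disc * (d_E4 f * d_E6 g))"
    "homog (0 + 12 + ((k - 6) + (l - 4))) (0 + 0 + (s + t)) (2 * Disc * (d_E6 f * d_E4 g))"
    "homog (0 + (k + (l + 2))) (0 + (s + t)) (scal (\<alpha> / 2) * ((E2 * d_E2 f) * ham_Disc g))"
    "homog (0 + ((k + 2) + l)) (0 + (s + t)) (scal (\<alpha> / 2) * (ham_Disc f * (E2 * d_E2 g)))"
    by (intro homog_mult homog_numeral homog_Disc homog_d_E4 homog_d_E6 homog_E2_d_E2 homog_ham_Disc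
          homog_scal f g)+
  then show ?thesis
    unfolding jac by (intro homog_add homog_diff homog_uminus) (simp_all add: algebra_simps)
qed

section \<open>Compatibility with the Rankin-Cohen bracket\<close>

lemma modular_forms_iff: "f \<in> modular_forms \<longleftrightarrow> d_E2 f = 0"
  unfolding modular_forms_def d_E2_def pderiv_eq_0_iff
  by (auto simp: image_iff elim: degree_eq_zeroE)

text \<open>Euler's identity: \<open>E4 * d_E4\<close> and \<open>E6 * d_E6\<close> multiply the
  monomial E4^i E6^j by i and j, and 4 i + 6 j = k on the support.\<close>

lemma euler_modular_forms_wt:
  assumes "f \<in> modular_forms_wt k"
  shows "scal (of_int k) * f = 4 * E4 * d_E4 f + 6 * E6 * d_E6 f"
proof (rule qmod_eqI)
  fix a i j
  obtain h where f: "f = [:h:]" and h: "\<And>i j. coeff (coeff h i) j \<noteq> 0 \<Longrightarrow> 4 * int i + 6 * int j = k"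
    using assms by (auto simp: modular_forms_wt_def)
  have "qcoeff f a i j \<noteq> 0 \<Longrightarrow> k = 4 * int i + 6 * int j"
    by (auto simp: f coeff_pCons split: nat.splits dest: h)
  then have "of_int k * qcoeff f a i j = 4 * (of_nat i * qcoeff f a i j) + 6 * (of_nat j * qcoeff f a i j)"
    by (cases "qcoeff f a i j = 0") (simp_all add: algebra_simps)
  moreover have "qcoeff (E4 * d_E4 f) a i j = of_nat i * qcoeff f a i j"
    "qcoeff (E6 * d_E6 f) a i j = of_nat j * qcoeff f a i j"
    by (simp_all add: qcoeff_gen_mult qcoeff_d del: of_nat_Suc split: nat.splits)
  moreover have "4 * E4 * d_E4 f + 6 * E6 * d_E6 f
    = scal 4 * (E4 * d_E4 f) + scal 6 * (E6 * d_E6 f)"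
    by (simp add: scal_numeral mult.assoc)
  ultimately show "qcoeff (scal (of_int k) * f) a i j = qcoeff (4 * E4 * d_E4 f + 6 * E6 * d_E6 f) a i j"
    by (simp add: qcoeff_scal_mult)
qed

lemma qm_fun_simps:
  "qm_fun (f + g) \<tau> = qm_fun f \<tau> + qm_fun g \<tau>" "qm_fun (f * g) \<tau> = qm_fun f \<tau> * qm_fun g \<tau>"
  "qm_fun (f - g) \<tau> = qm_fun f \<tau> - qm_fun g \<tau>" "qm_fun (- f) \<tau> = - qm_fun f \<tau>"
  "qm_fun (f ^ n) \<tau> = qm_fun f \<tau> ^ n"
  "qm_fun (numeral m) \<tau> = numeral m" "qm_fun (scal c) \<tau> = c"
  "qm_fun E4 \<tau> = E4_fun \<tau>" "qm_fun E6 \<tau> = E6_fun \<tau>"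
  by (simp_all add: qm_fun_def scal_def E4_def E6_def)

text \<open>The chain rule along \<open>E4_fun\<close> and \<open>E6_fun\<close>, by Horner
  recursion in \<open>E4\<close> with coefficients that are ordinary polynomials in
  \<open>E6\<close>.\<close>

lemma qm_fun_modular_has_derivative:
  assumes "(E4_fun has_field_derivative e4) (at \<tau>)" "(E6_fun has_field_derivative e6) (at \<tau>)"
  shows "(qm_fun [:f:] has_field_derivative (qm_fun (d_E4 [:f:]) \<tau> * e4 + qm_fun (d_E6 [:f:]) \<tau> * e6)) (at \<tau>)"
proof (induction f)
  case 0
  have "qm_fun [:0:] = (\<lambda>_. 0)" "d_E4 [:0:] = 0" "d_E6 [:0:] = 0"
    by (simp_all add: qm_fun_def[abs_def])
  then show ?case by (simp add: qm_fun_def)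
next
  case (pCons c f)
  have split: "[:pCons c f:] = [:[:c:]:] + E4 * [:f:]" by (simp add: E4_def)
  have const: "qm_fun [:[:c:]:] = (\<lambda>\<tau>. poly c (E6_fun \<tau>))" "d_E4 [:[:c:]:] = 0"
    "d_E6 [:[:c:]:] = [:[:pderiv c:]:]"
    by (simp_all add: qm_fun_def[abs_def] d_E4_def d_E6_def map_poly_pCons pderiv_pCons)
  have c: "(qm_fun [:[:c:]:] has_field_derivative qm_fun [:[:pderiv c:]:] \<tau> * e6) (at \<tau>)"
    unfolding const using DERIV_chain2[OF poly_DERIV assms(2)] by (simp add: qm_fun_def)
  have "qm_fun [:pCons c f:] = (\<lambda>\<tau>. qm_fun [:[:c:]:] \<tau> + E4_fun \<tau> * qm_fun [:f:] \<tau>)"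
    unfolding split by (simp add: qm_fun_simps fun_eq_iff del: mult_pCons_right)
  then show ?case
    using DERIV_add[OF c DERIV_mult[OF assms(1) pCons(2)]]
    unfolding split by (simp add: const qm_fun_simps qm_fun_def[of 0] algebra_simps del: mult_pCons_right)
qed

lemma D_qm_fun_modular:
  assumes "f \<in> modular_forms" "Im \<tau> > 0"
  shows "D (qm_fun f) \<tau> = qm_fun (d_E4 f) \<tau> * D E4_fun \<tau> + qm_fun (d_E6 f) \<tau> * D E6_fun \<tau>"
proof -
  obtain h where f: "f = [:h:]" using assms(1) by (auto simp: modular_forms_def)
  have d4: "(E4_fun has_field_derivative deriv E4_fun \<tau>) (at \<tau>)"
    using E4_fun_has_derivative[OF assms(2)] DERIV_imp_deriv by metis
  have d6: "(E6_fun has_field_derivative deriv E6_fun \<tau>) (at \<tau>)"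
    using E6_fun_has_derivative[OF assms(2)] DERIV_imp_deriv by metis
  show ?thesis
    unfolding f D_def DERIV_imp_deriv[OF qm_fun_modular_has_derivative[OF d4 d6]]
    by (simp only: add_divide_distrib times_divide_eq_right)
qed

lemma restricts_to_RC1_br: "restricts_to_RC1 (br \<alpha>)"
  unfolding restricts_to_RC1_def
proof (intro allI ballI conjI impI)
  fix k l f g assume f: "f \<in> modular_forms_wt k" and g: "g \<in> modular_forms_wt l"
  have mf: "f \<in> modular_forms" "g \<in> modular_forms"
    using f g by (auto simp: modular_forms_wt_def modular_forms_def)
  then have dx: "d_E2 f = 0" "d_E2 g = 0" by (simp_all add: modular_forms_iff)
  then show "br \<alpha> f g \<in> modular_forms"
    by (simp add: modular_forms_iff br_def modular_jacobian_def d_commute)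
  fix \<tau> :: complex assume \<tau>: "Im \<tau> > 0"
  have k: "of_int k * qm_fun f \<tau> = 4 * E4_fun \<tau> * qm_fun (d_E4 f) \<tau> + 6 * E6_fun \<tau> * qm_fun (d_E6 f) \<tau>"
    and l: "of_int l * qm_fun g \<tau> = 4 * E4_fun \<tau> * qm_fun (d_E4 g) \<tau> + 6 * E6_fun \<tau> * qm_fun (d_E6 g) \<tau>"
    using arg_cong[OF euler_modular_forms_wt[OF f], of "\<lambda>h. qm_fun h \<tau>"]
      arg_cong[OF euler_modular_forms_wt[OF g], of "\<lambda>h. qm_fun h \<tau>"]
    by (simp_all add: qm_fun_simps)
  \<comment> \<open>Replacing k f and l g by Euler's identity cancels the products of two
    \<open>d_E4\<close> or of two \<open>d_E6\<close> derivatives; what remains is the Jacobian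
    times the bracket of \<open>E4\<close> and \<open>E6\<close>.\<close>
  have "RC1 k l (qm_fun f) (qm_fun g) \<tau>
    = (qm_fun (d_E4 f) \<tau> * qm_fun (d_E6 g) \<tau> - qm_fun (d_E6 f) \<tau> * qm_fun (d_E4 g) \<tau>)
      * (4 * E4_fun \<tau> * D E6_fun \<tau> - 6 * E6_fun \<tau> * D E4_fun \<tau>)"
    unfolding RC1_def D_qm_fun_modular[OF mf(1) \<tau>] D_qm_fun_modular[OF mf(2) \<tau>] k l
    by (simp add: algebra_simps)
  then show "qm_fun (br \<alpha> f g) \<tau> = RC1 k l (qm_fun f) (qm_fun g) \<tau>"
    unfolding RC1_E4_E6[OF \<tau>] by (simp add: br_def dx modular_jacobian_def Disc_def qm_fun_simps algebra_simps)
qed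

lemma admissible_br: "admissible (br \<alpha>)"
  by (simp add: admissible_def poisson_bracket_br restricts_to_RC1_br quasimodular_forms_wt_iff
        homog_br Ball_def)

section \<open>The Poisson centre\<close>

text \<open>The extra factor w avoids the exponent n - 1, so n = 0 is covered uniformly.\<close>

lemma derivation_power:
  fixes d :: "'a::comm_ring_1 \<Rightarrow> 'a"
  assumes "\<And>a b. d (a * b) = a * d b + d a * b"
  shows "w * d (w ^ n) = of_nat n * w ^ n * d w"
proof (induction n)
  case 0
  have "d 1 = 0" using assms[of 1 1] by simp
  then show ?case by simp
next
  case (Suc n)
  have "w * d (w ^ Suc n) = w * (w * d (w ^ n)) + w ^ Suc n * d w"
    by (simp add: assms algebra_simps)
  then show ?case by (simp add: Suc algebra_simps)
qed

text \<open>\<open>Disc\<close> inside the coefficient ring, as a monic cubic in \<open>E4\<close>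
  over the polynomials in \<open>E6\<close>.\<close>

definition disc :: "complex poly poly" where
  "disc = [:[:0, 0, - 1:], 0, 0, 1:]"

lemma Disc_eq: "Disc = [:disc:]"
  by (simp add: Disc_def disc_def E4_def E6_def power3_eq_cube power2_eq_square one_pCons)

lemma coeff_disc_mult:
  "coeff (disc * p) n = (if n < 3 then 0 else coeff p (n - 3)) - [:0, 0, 1:] * coeff p n"
proof -
  have "disc * p = pCons 0 (pCons 0 (pCons 0 p)) - smult [:0, 0, 1:] p"
  proof -
    have "[:0, 0, - 1:] = - [:0, 0, 1 :: complex:]" by simp
    then show ?thesis unfolding disc_def by (simp add: pCons_one del: minus_pCons)
  qed
  then show ?thesis
    by (auto simp: coeff_pCons numeral_3_eq_3 split: nat.splits)
qed

text \<open>Comparing coefficients in the equation gives the recursion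
  \<open>(3 s - m) h\<^sub>m = - (m + 3) z\<^sup>2 h\<^sub>m\<^sub>+\<^sub>3\<close>, together with \<open>h\<^sub>1 = h\<^sub>2 = 0\<close>.\<close>

lemma degree_disc_ode:
  assumes ode: "disc * pderiv h = [:0, 0, [:3 * s:]:] * h" and "h \<noteq> 0"
  shows "\<exists>n. s = of_nat n \<and> degree h = 3 * n"
proof -
  have rhs: "coeff ([:0, 0, [:3 * s:]:] * h) m = (if m < 2 then 0 else smult (3 * s) (coeff h (m - 2)))" for m
    by (auto simp: coeff_pCons numeral_2_eq_2 split: nat.splits)
  have z: "[:0, 0, 1:] \<noteq> (0 :: complex poly)" by simp
  have low: "coeff h 1 = 0" "coeff h 2 = 0"
    using arg_cong[OF ode, of "\<lambda>p. coeff p 0"] arg_cong[OF ode, of "\<lambda>p. coeff p 1"]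
    unfolding coeff_disc_mult rhs by (simp_all add: coeff_pderiv numeral_2_eq_2)
  have rec: "of_nat m * coeff h m - [:0, 0, 1:] * (of_nat (m + 3) * coeff h (m + 3)) = smult (3 * s) (coeff h m)" for m
  proof (cases m)
    case 0
    then show ?thesis
      using arg_cong[OF ode, of "\<lambda>p. coeff p 2"] unfolding coeff_disc_mult rhs
      by (simp add: coeff_pderiv numeral_3_eq_3 numeral_2_eq_2)
  next
    case (Suc k)
    then show ?thesis
      using arg_cong[OF ode, of "\<lambda>p. coeff p (m + 2)"] unfolding coeff_disc_mult rhs
      by (simp add: coeff_pderiv numeral_3_eq_3 numeral_2_eq_2)
  qed
  have step: "coeff h (m + 3) = 0" if "coeff h m = 0" for m
    using rec[of m] that z by (simp del: of_nat_add)
  have zero: "coeff h (3 * i + 1) = 0 \<and> coeff h (3 * i + 2) = 0" for i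
  proof (induction i)
    case (Suc i)
    then show ?case using step[of "3 * i + 1"] step[of "3 * i + 2"] by (simp add: algebra_simps)
  qed (use low in \<open>simp add: numeral_2_eq_2\<close>)
  let ?d = "degree h"
  \<comment> \<open>At the top degree the coefficient three places higher is 0, so the recursion
    forces the degree of \<open>h\<close> to be 3 s.\<close>
  have "coeff h (?d + 3) = 0" by (rule coeff_eq_0) simp
  then have "smult (of_nat ?d) (lead_coeff h) = smult (3 * s) (lead_coeff h)"
    using rec[of ?d] by (simp add: of_nat_poly)
  then have "smult (of_nat ?d - 3 * s) (lead_coeff h) = 0" by (simp only: smult_diff_left diff_self)
  then have s: "of_nat ?d = 3 * s"
    using \<open>h \<noteq> 0\<close> by (simp only: smult_eq_0_iff leading_coeff_0_iff right_minus_eq simp_thms)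
  have "?d mod 3 = 0"
  proof (rule ccontr)
    assume "?d mod 3 \<noteq> 0"
    then have "?d mod 3 = 1 \<or> ?d mod 3 = 2" by linarith
    then have "?d = 3 * (?d div 3) + 1 \<or> ?d = 3 * (?d div 3) + 2" by presburger
    then have "lead_coeff h = 0" using zero[of "?d div 3"] by metis
    then show False using \<open>h \<noteq> 0\<close> by simp
  qed
  then have d: "?d = 3 * (?d div 3)" by presburger
  then have "3 * s = 3 * of_nat (?d div 3)"
    using s by (metis of_nat_mult of_nat_numeral)
  with d show ?thesis by auto
qed

text \<open>The equation in \<open>E4\<close> determines \<open>h\<close> up to a factor depending
  on \<open>E6\<close> alone; the equation in \<open>E6\<close> then makes that factor
  constant.\<close>

lemma disc_ode_solution:
  assumes odeY: "disc * pderiv h = [:0, 0, [:3 * s:]:] * h"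
    and odeZ: "disc * map_poly pderiv h = [:[:0, - 2 * s:]:] * h"
    and "h \<noteq> 0"
  shows "\<exists>n c. s = of_nat n \<and> h = [:[:c:]:] * disc ^ n"
proof -
  obtain n where n: "s = of_nat n" "degree h = 3 * n"
    using degree_disc_ode[OF odeY \<open>h \<noteq> 0\<close>] by blast
  define c where "c = lead_coeff h"
  define u where "u = disc ^ n"
  have top: "coeff u (3 * n) = 1" "degree u = 3 * n"
  proof -
    have deg: "degree disc = 3" and lc: "lead_coeff disc = 1" by (simp_all add: disc_def)
    show du: "degree u = 3 * n" unfolding u_def by (subst degree_power_eq) (use deg in auto)
    have "lead_coeff u = 1" unfolding u_def lead_coeff_power lc by simp
    then show "coeff u (3 * n) = 1" by (simp only: du)
  qed
  have "pderiv disc = [:0, 0, [:3:]:]" by (simp add: disc_def pderiv_pCons numeral_poly one_pCons)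
  moreover have "map_poly pderiv disc = [:[:0, - 2:]:]" by (simp add: disc_def map_poly_pCons pderiv_pCons)
  moreover have "disc * pderiv u = of_nat n * u * pderiv disc"
    unfolding u_def by (rule derivation_power) (simp add: pderiv_mult mult.commute)
  moreover have "disc * map_poly pderiv u = of_nat n * u * map_poly pderiv disc"
    unfolding u_def by (rule derivation_power) (rule map_poly_pderiv_Leibniz)
  ultimately have uY: "disc * pderiv u = [:0, 0, [:3 * s:]:] * u"
    and uZ: "disc * map_poly pderiv u = [:[:0, - 2 * s:]:] * u"
    by (simp_all add: n(1) of_nat_poly algebra_simps)
  \<comment> \<open>The difference solves the same linear equation, so if nonzero it would have
    degree 3 n; but its coefficient there is 0 by the choice of \<open>c\<close>.\<close>
  have h: "h = [:c:] * u"
  proof (rule ccontr)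
    assume ne: "h \<noteq> [:c:] * u"
    let ?e = "h - [:c:] * u"
    have "pderiv ?e = pderiv h - [:c:] * pderiv u"
      by (simp add: pderiv_diff pderiv_smult)
    then have "disc * pderiv ?e = disc * pderiv h - [:c:] * (disc * pderiv u)"
      by (simp only: right_diff_distrib mult_ac)
    also have "\<dots> = [:0, 0, [:3 * s:]:] * ?e"
      unfolding odeY uY by (simp only: right_diff_distrib left_diff_distrib mult_ac)
    finally have "disc * pderiv ?e = [:0, 0, [:3 * s:]:] * ?e" .
    from degree_disc_ode[OF this] ne obtain m where "s = of_nat m" "degree ?e = 3 * m" by auto
    then have "degree ?e = 3 * n" using n(1) by simp
    moreover have "coeff ?e (3 * n) = 0" using top n(2) by (simp add: c_def)
    ultimately have "?e = 0" by (metis leading_coeff_0_iff)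
    then show False using ne by simp
  qed
  have "map_poly pderiv h = [:pderiv c:] * u + [:c:] * map_poly pderiv u"
    unfolding h map_poly_pderiv_Leibniz by (simp add: map_poly_pCons algebra_simps)
  then have "disc * map_poly pderiv h = disc * ([:pderiv c:] * u) + [:c:] * (disc * map_poly pderiv u)"
    by (simp only: distrib_left mult_ac)
  also have "[:c:] * (disc * map_poly pderiv u) = disc * map_poly pderiv h"
    unfolding uZ odeZ by (subst h) (simp only: mult_ac)
  finally have "disc * ([:pderiv c:] * u) = 0" by simp
  moreover have "u \<noteq> 0" "disc \<noteq> 0" using top by (auto simp: disc_def)
  ultimately have "pderiv c = 0" by simp
  then obtain c0 where "c = [:c0:]" by (metis pderiv_eq_0_iff degree_eq_zeroE)
  then show ?thesis using h n(1) unfolding u_def by blast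
qed

lemma coeff_E2_d_E2: "coeff (E2 * d_E2 g) k = of_nat k * coeff g k"
  using coeff_E2_power_mult[of 1 "d_E2 g" k] by (cases k) (simp_all add: coeff_d_E2 del: of_nat_Suc)

text \<open>The brackets with \<open>E4\<close> and \<open>E6\<close> vanish, and
  \<open>E2 * d_E2\<close> multiplies the k-th coefficient in \<open>E2\<close> by k, so that
  coefficient satisfies the two equations of \<open>disc_ode_solution\<close> with s = \<alpha> k /
  4.\<close>

lemma center_coeff:
  assumes "g \<in> poisson_center (br \<alpha>)" "coeff g k \<noteq> 0"
  shows "\<exists>n c. \<alpha> * of_nat k / 4 = of_nat n \<and> coeff g k = [:[:c:]:] * disc ^ n"
proof (rule disc_ode_solution)
  have "br \<alpha> E4 g = 0" "br \<alpha> E6 g = 0"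
    using assms(1) by (simp_all add: poisson_center_def)
  moreover have "br \<alpha> E4 g = - 2 * (Disc * d_E6 g + scal (\<alpha> / 2) * E6 * (E2 * d_E2 g))"
    "br \<alpha> E6 g = 2 * (Disc * d_E4 g) - 3 * scal (\<alpha> / 2) * E4 ^ 2 * (E2 * d_E2 g)"
    by (simp_all add: br_def modular_jacobian_def ham_Disc_def algebra_simps)
  ultimately have "Disc * d_E6 g + scal (\<alpha> / 2) * E6 * (E2 * d_E2 g) = 0"
    and eq4: "2 * (Disc * d_E4 g) = 3 * scal (\<alpha> / 2) * E4 ^ 2 * (E2 * d_E2 g)"
    by (simp_all only: mult_eq_0_iff neg_equal_0_iff_equal zero_neq_numeral[symmetric] simp_thms
          eq_iff_diff_eq_0[symmetric])
  then have *: "Disc * d_E6 g = - (scal (\<alpha> / 2) * E6) * (E2 * d_E2 g)"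
    by (simp only: mult_minus_left eq_neg_iff_add_eq_0)
  from eq4 have "scal (1 / 2) * (2 * (Disc * d_E4 g)) = scal (1 / 2) * (scal 3 * scal (\<alpha> / 2) * E4 ^ 2 * (E2 * d_E2 g))"
    by (simp only: scal_numeral)
  moreover have "scal (1 / 2) * (2 * (Disc * d_E4 g)) = scal (1 / 2 * 2) * (Disc * d_E4 g)"
    by (simp only: scal_simps scal_numeral mult_ac)
  moreover have "scal (1 / 2) * (scal 3 * scal (\<alpha> / 2) * E4 ^ 2 * (E2 * d_E2 g))
     = scal (3 * \<alpha> / 4) * E4 ^ 2 * (E2 * d_E2 g)"
    by (simp add: mult.assoc[symmetric] scal_simps(4)[symmetric])
  ultimately have **: "Disc * d_E4 g = scal (3 * \<alpha> / 4) * E4 ^ 2 * (E2 * d_E2 g)"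
    by (simp add: scal_simps)
  have const: "coeff ([:a:] * f) k = a * coeff f k" for a :: "complex poly poly" and f
    by simp
  have E: "scal (3 * \<alpha> / 4) * E4 ^ 2 = [:[:0, 0, [:3 * \<alpha> / 4:]:]:]"
    "- (scal (\<alpha> / 2) * E6) = [:[:[:0, - (\<alpha> / 2):]:]:]"
    by (simp_all add: scal_def E4_def E6_def power2_eq_square)
  show "disc * pderiv (coeff g k) = [:0, 0, [:3 * (\<alpha> * of_nat k / 4):]:] * coeff g k"
    using arg_cong[OF **, of "\<lambda>f. coeff f k"]
    unfolding Disc_eq E const coeff_E2_d_E2 coeff_d_E4 by (simp add: of_nat_poly mult_ac)
  show "disc * map_poly pderiv (coeff g k) = [:[:0, - 2 * (\<alpha> * of_nat k / 4):]:] * coeff g k"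
    using arg_cong[OF *, of "\<lambda>f. coeff f k"]
    unfolding Disc_eq E const coeff_E2_d_E2 coeff_d_E6 by (simp add: of_nat_poly mult_ac)
qed (rule assms(2))

section \<open>One-generator subalgebras and Casimir elements\<close>

lemma gen_subalgebra_0: "0 \<in> gen_subalgebra G"
  unfolding gen_subalgebra_def by (rule image_eqI[of _ _ 0]) auto

lemma gen_subalgebra_add: "f \<in> gen_subalgebra G \<Longrightarrow> g \<in> gen_subalgebra G \<Longrightarrow> f + g \<in> gen_subalgebra G"
  unfolding gen_subalgebra_def
proof (elim imageE)
  fix P Q assume "f = poly (map_poly scal P) G" "g = poly (map_poly scal Q) G"
  then show "f + g \<in> range (\<lambda>P. poly (map_poly scal P) G)"
    by (intro image_eqI[of _ _ "P + Q"]) (simp_all add: map_poly_additive scal_simps)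
qed

lemma gen_subalgebra_sum: "(\<And>i. i \<in> A \<Longrightarrow> f i \<in> gen_subalgebra G) \<Longrightarrow> (\<Sum>i\<in>A. f i) \<in> gen_subalgebra G"
  by (induction A rule: infinite_finite_induct) (auto intro: gen_subalgebra_0 gen_subalgebra_add)

lemma gen_subalgebra_monomial: "scal c * G ^ n \<in> gen_subalgebra G"
proof -
  have "map_poly scal (monom c n) = monom (scal c) n"
    by (rule map_poly_monom) (simp add: scal_simps)
  then show ?thesis
    unfolding gen_subalgebra_def by (intro image_eqI[of _ _ "monom c n"]) (simp_all add: poly_monom)
qed

lemma gen_subalgebra_subset_center:
  assumes b: "\<And>f. br \<alpha> f G = 0"
  shows "gen_subalgebra G \<subseteq> poisson_center (br \<alpha>)"
proof -
  have const0: "br \<alpha> f (scal c) = 0" for f c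
    by (simp add: br_def modular_jacobian_def ham_Disc_def)
  have add: "br \<alpha> f (g + h) = br \<alpha> f g + br \<alpha> f h" for f g h
    by (simp add: br_def modular_jacobian_def ham_Disc_def algebra_simps)
  have mult: "br \<alpha> f (g * h) = br \<alpha> f g * h + g * br \<alpha> f h" for f g h
    by (simp add: br_def modular_jacobian_def ham_Disc_def algebra_simps)
  have "br \<alpha> f (poly (map_poly scal P) G) = 0" for f P
  proof (induction P)
    case 0
    show ?case using const0[of f 0] by (simp add: scal_simps)
  next
    case (pCons c P)
    then show ?case by (simp add: map_poly_pCons scal_simps(1) add mult const0 b)
  qed
  then show ?thesis by (auto simp: gen_subalgebra_def poisson_center_def)
qed

text \<open>With G = Disc^p E2^q, logarithmic differentiation gives dG/G = p dDisc/Disc + q dE2/E2,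
  and the condition on \<alpha> balances the two parts. The proof works with products by
  \<open>Disc\<close> and \<open>E2\<close> in place of quotients.\<close>

lemma br_Casimir:
  assumes "\<alpha> * of_nat q = 4 * of_nat p"
  shows "br \<alpha> f (Disc ^ p * E2 ^ q) = 0"
proof -
  let ?G = "Disc ^ p * E2 ^ q"
  have Dp: "Disc * d_E4 (Disc ^ p) = of_nat p * Disc ^ p * (3 * E4 ^ 2)"
    "Disc * d_E6 (Disc ^ p) = of_nat p * Disc ^ p * (- 2 * E6)"
    "Disc * d_E2 (Disc ^ p) = of_nat p * Disc ^ p * 0"
    using derivation_power[of d_E4 Disc p, OF d_mult(2)] derivation_power[of d_E6 Disc p, OF d_mult(3)]
      derivation_power[of d_E2 Disc p, OF d_mult(1)] by simp_all
  have Eq: "E2 * d_E4 (E2 ^ q) = of_nat q * E2 ^ q * 0" "E2 * d_E6 (E2 ^ q) = of_nat q * E2 ^ q * 0"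
    "E2 * d_E2 (E2 ^ q) = of_nat q * E2 ^ q * 1"
    using derivation_power[of d_E4 E2 q, OF d_mult(2)] derivation_power[of d_E6 E2 q, OF d_mult(3)]
      derivation_power[of d_E2 E2 q, OF d_mult(1)] by simp_all
  have ne: "Disc \<noteq> 0" "E2 \<noteq> 0" by (simp_all add: Disc_eq disc_def E2_def)
  then have z: "d_E2 (Disc ^ p) = 0" "d_E4 (E2 ^ q) = 0" "d_E6 (E2 ^ q) = 0"
    using Dp(3) Eq(1,2) by simp_all
  have D4: "Disc * d_E4 ?G = 3 * of_nat p * E4 ^ 2 * ?G"
    using arg_cong[OF Dp(1), of "\<lambda>t. t * E2 ^ q"] by (simp add: z mult_ac)
  have D6: "Disc * d_E6 ?G = - (2 * of_nat p * E6 * ?G)"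
    using arg_cong[OF Dp(2), of "\<lambda>t. t * E2 ^ q"] by (simp add: z mult_ac)
  have D2: "E2 * d_E2 ?G = of_nat q * ?G"
    using arg_cong[OF Eq(3), of "\<lambda>t. Disc ^ p * t"] by (simp add: z mult_ac)
  have "Disc * ham_Disc ?G = 2 * E6 * (Disc * d_E4 ?G) + 3 * E4 ^ 2 * (Disc * d_E6 ?G)"
    unfolding ham_Disc_def by (simp only: distrib_left mult_ac)
  also have "\<dots> = 0" unfolding D4 D6 by (simp only: mult_ac) algebra
  finally have ham: "ham_Disc ?G = 0" using ne by simp
  have "scal (\<alpha> / 2) * of_nat q = scal (\<alpha> / 2 * of_nat q)"
    by (simp add: scal_def of_nat_poly)
  also have "\<alpha> / 2 * of_nat q = 2 * of_nat p" using assms by (simp add: field_simps)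
  also have "scal (2 * of_nat p) = 2 * of_nat p"
    by (simp add: scal_def of_nat_poly numeral_poly)
  finally have sc: "scal (\<alpha> / 2) * of_nat q = 2 * of_nat p" .
  have "br \<alpha> f ?G = - 2 * (d_E4 f * (Disc * d_E6 ?G) - d_E6 f * (Disc * d_E4 ?G))
      + scal (\<alpha> / 2) * E2 * d_E2 f * ham_Disc ?G - scal (\<alpha> / 2) * ham_Disc f * (E2 * d_E2 ?G)"
    unfolding br_def modular_jacobian_def by (simp only: algebra_simps)
  also have "\<dots> = - 2 * (d_E4 f * (Disc * d_E6 ?G) - d_E6 f * (Disc * d_E4 ?G))
      - scal (\<alpha> / 2) * of_nat q * ham_Disc f * ?G"
    unfolding ham D2 by (simp add: mult_ac)
  also have "\<dots> = 0"
    unfolding D4 D6 sc ham_Disc_def by (simp add: algebra_simps)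
  finally show ?thesis .
qed

text \<open>A nonzero coefficient of E2^k in a central element is c disc^n with p k = n q;
  coprimality gives k = q m and n = p m, so each term is a scalar multiple of the m-th power of the
  generator.\<close>

theorem poisson_center_br:
  assumes \<alpha>: "\<alpha> * of_nat q = 4 * of_nat p" and "coprime p q" "q > 0"
  shows "poisson_center (br \<alpha>) = gen_subalgebra (Disc ^ p * E2 ^ q)"
proof
  let ?G = "Disc ^ p * E2 ^ q"
  show "gen_subalgebra ?G \<subseteq> poisson_center (br \<alpha>)"
    by (rule gen_subalgebra_subset_center) (rule br_Casimir[OF \<alpha>])
  show "poisson_center (br \<alpha>) \<subseteq> gen_subalgebra ?G"
  proof
    fix g assume g: "g \<in> poisson_center (br \<alpha>)"
    have "[:coeff g k:] * E2 ^ k \<in> gen_subalgebra ?G" for k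
    proof (cases "coeff g k = 0")
      case True
      then show ?thesis by (simp add: gen_subalgebra_0)
    next
      case False
      from center_coeff[OF g this] obtain n c where n: "\<alpha> * of_nat k / 4 = of_nat n"
        and c: "coeff g k = [:[:c:]:] * disc ^ n" by blast
      have "of_nat (p * k) = (of_nat (n * q) :: complex)"
        using \<alpha> n by (simp add: field_simps) (metis mult.assoc mult.commute mult_cancel_left zero_neq_numeral)
      then have pk: "p * k = n * q" by (simp only: of_nat_eq_iff)
      then have "q dvd p * k" by simp
      then have "q dvd k" using \<open>coprime p q\<close> by (simp add: coprime_commute coprime_dvd_mult_right_iff)
      then obtain m where m: "k = q * m" by (elim dvdE)
      with pk \<open>q > 0\<close> have "n = p * m" by simp
      moreover have "[:coeff g k:] = scal c * Disc ^ n"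
        by (simp add: c scal_def Disc_eq poly_const_pow mult.commute)
      ultimately have "[:coeff g k:] * E2 ^ k = scal c * ?G ^ m"
        by (simp add: m power_mult_distrib power_mult mult.assoc)
      then show ?thesis by (simp only: gen_subalgebra_monomial)
    qed
    then have "(\<Sum>k\<le>degree g. [:coeff g k:] * E2 ^ k) \<in> gen_subalgebra ?G"
      by (intro gen_subalgebra_sum)
    moreover have "(\<Sum>k\<le>degree g. [:coeff g k:] * E2 ^ k) = g"
      using poly_as_sum_of_monoms[of g] by (simp add: monom_altdef E2_def)
    ultimately show "g \<in> gen_subalgebra ?G" by (simp only:)
  qed
qed

theorem poisson_center_br_trivial:
  assumes "\<And>k n :: nat. k > 0 \<Longrightarrow> \<alpha> * of_nat k \<noteq> 4 * of_nat n"
  shows "poisson_center (br \<alpha>) = range scal"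
proof
  show "range scal \<subseteq> poisson_center (br \<alpha>)"
    by (auto simp: poisson_center_def br_def modular_jacobian_def ham_Disc_def)
  show "poisson_center (br \<alpha>) \<subseteq> range scal"
  proof
    fix g assume g: "g \<in> poisson_center (br \<alpha>)"
    have high: "coeff g k = 0" if "k > 0" for k
    proof (rule ccontr)
      assume "coeff g k \<noteq> 0"
      from center_coeff[OF g this] obtain n where "\<alpha> * of_nat k / 4 = of_nat n" by blast
      then have "\<alpha> * of_nat k = 4 * of_nat n" by (simp add: field_simps)
      with assms[OF that] show False by blast
    qed
    have g0: "g = [:coeff g 0:]"
      by (rule poly_eqI) (use high in \<open>auto simp: coeff_pCons split: nat.splits\<close>)
    show "g \<in> range scal"
    proof (cases "coeff g 0 = 0")
      case True
      then have "g = scal 0" using g0 by (simp add: scal_simps)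
      then show ?thesis by blast
    next
      case False
      from center_coeff[OF g this] obtain c where "coeff g 0 = [:[:c:]:]" by auto
      then have "g = scal c" using g0 by (simp add: scal_def)
      then show ?thesis by blast
    qed
  qed
qed

section \<open>Modular isomorphisms\<close>

lemma map_poly_mult_hom:
  fixes f :: "'a::comm_semiring_1 \<Rightarrow> 'b::comm_semiring_1"
  assumes "f 0 = 0" "\<And>a b. f (a + b) = f a + f b" "\<And>a b. f (a * b) = f a * f b"
  shows "map_poly f (p * q) = map_poly f p * map_poly f q"
  by (rule poly_eqI) (simp add: coeff_map_poly assms(1) coeff_mult sum_additive[OF assms(1,2)] assms(3))

text \<open>The substitution \<open>E4 \<mapsto> E2\<^sup>2 E4\<close>, \<open>E6 \<mapsto> E2\<^sup>3 E6\<close>, \<open>E2 \<mapsto> 0\<close>: on modular forms the degree in \<open>E2\<close> of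
  the result is half the weight.\<close>

definition weight_inner :: "complex poly \<Rightarrow> qmod" where
  "weight_inner c = poly (map_poly scal c) (E2 ^ 3 * E6)"

definition weight_hom :: "qmod \<Rightarrow> qmod" where
  "weight_hom f = poly (map_poly weight_inner (coeff f 0)) (E2 ^ 2 * E4)"

lemma weight_inner_simps:
  "weight_inner 0 = 0" "weight_inner (a + b) = weight_inner a + weight_inner b"
  "weight_inner (a * b) = weight_inner a * weight_inner b"
  "weight_inner (pCons c a) = scal c + E2 ^ 3 * E6 * weight_inner a"
  by (simp_all add: weight_inner_def map_poly_additive map_poly_mult_hom scal_simps map_poly_pCons)

lemma weight_hom_simps:
  "weight_hom (f + g) = weight_hom f + weight_hom g"
  "weight_hom (f * g) = weight_hom f * weight_hom g"
  "weight_hom (scal c) = scal c" "weight_hom E2 = 0"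
  "weight_hom E4 = E2 ^ 2 * E4" "weight_hom E6 = E2 ^ 3 * E6"
  by (simp_all add: weight_hom_def map_poly_additive map_poly_mult_hom weight_inner_simps coeff_mult_0
        scal_def[of c] E2_def[abs_def] map_poly_pCons)
     (simp_all add: scal_simps weight_inner_simps map_poly_pCons E4_def E6_def E2_def one_pCons scal_def)

lemma qcoeff_weight_inner:
  "qcoeff (weight_inner c) k i j = (if i = 0 \<and> k = 3 * j then coeff c j else 0)"
proof (induction c arbitrary: k i j)
  case 0
  show ?case by (simp add: weight_inner_simps)
next
  case (pCons a c)
  have "qcoeff (E2 ^ 3 * (E6 * weight_inner c)) k i j
     = (if k < 3 then 0 else case j of 0 \<Rightarrow> 0 | Suc j' \<Rightarrow> qcoeff (weight_inner c) (k - 3) i j')"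
    by (simp add: coeff_E2_power_mult qcoeff_gen_mult)
  moreover have "qcoeff (scal a) k i j = (if k = 0 \<and> i = 0 \<and> j = 0 then a else 0)"
    by (auto simp: scal_def coeff_pCons split: nat.splits)
  ultimately show ?case
    by (auto simp: weight_inner_simps mult.assoc pCons coeff_pCons split: nat.splits)
qed

lemma qcoeff_weight_hom:
  "qcoeff (weight_hom [:h:]) k i j = (if k = 2 * i + 3 * j then coeff (coeff h i) j else 0)"
proof (induction h arbitrary: k i j)
  case 0
  show ?case by (simp add: weight_hom_def)
next
  case (pCons c h)
  have "qcoeff (E2 ^ 2 * (E4 * weight_hom [:h:])) k i j
     = (if k < 2 then 0 else case i of 0 \<Rightarrow> 0 | Suc i' \<Rightarrow> qcoeff (weight_hom [:h:]) (k - 2) i' j)"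
    by (simp add: coeff_E2_power_mult qcoeff_gen_mult)
  moreover have "weight_hom [:pCons c h:] = weight_inner c + E2 ^ 2 * (E4 * weight_hom [:h:])"
    by (simp add: weight_hom_def map_poly_pCons weight_inner_simps mult.assoc)
  ultimately show ?case
    by (auto simp: qcoeff_weight_inner pCons coeff_pCons split: nat.splits)
qed

lemma ham_Disc_simps [simp]:
  "ham_Disc (f + g) = ham_Disc f + ham_Disc g"
  "ham_Disc (f * g) = f * ham_Disc g + ham_Disc f * g"
  "ham_Disc (scal c) = 0" "ham_Disc E2 = 0" "ham_Disc E4 = 2 * E6" "ham_Disc E6 = 3 * E4 ^ 2"
  by (simp_all add: ham_Disc_def algebra_simps)

text \<open>The factor \<open>E2\<close> reflects that \<open>ham_Disc\<close> raises half the
  weight by one; the identity passes from the generators to sums and products.\<close>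

lemma weight_hom_ham_Disc: "weight_hom (ham_Disc f) = E2 * ham_Disc (weight_hom f)"
proof (induction f rule: qmod_induct)
  case (scal c)
  show ?case using weight_hom_simps(3)[of 0] by (simp add: weight_hom_simps scal_simps)
next
  case E2
  show ?case using weight_hom_simps(3)[of 0] ham_Disc_simps(3)[of 0] by (simp add: weight_hom_simps scal_simps)
qed (simp_all add: weight_hom_simps weight_hom_simps(3)[of "numeral _", unfolded scal_numeral]
       power2_eq_square power3_eq_cube algebra_simps)

lemma degree_ham_Disc_le: "degree (ham_Disc f) \<le> degree f"
proof (rule degree_le, intro allI impI)
  fix k assume "degree f < k"
  then have "coeff f k = 0" by (rule coeff_eq_0)
  moreover have "2 * E6 = [:[:[:0, 2:]:]:]" "3 * E4 ^ 2 = [:[:0, 0, 3:]:]"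
    by (simp_all add: E4_def E6_def power2_eq_square numeral_poly)
  then have "coeff (ham_Disc f) k
     = [:[:0, 2:]:] * pderiv (coeff f k) + [:0, 0, 3:] * map_poly pderiv (coeff f k)"
    by (simp add: ham_Disc_def coeff_d_E4 coeff_d_E6)
  ultimately show "coeff (ham_Disc f) k = 0" by simp
qed

text \<open>Such a \<open>Y\<close> has weight at most \<open>4\<close>, because squaring doubles the weight while \<open>ham_Disc\<close>
  raises it by \<open>2\<close>.\<close>

lemma ham_Disc_quadratic_solution:
  assumes Y: "Y \<in> modular_forms" and "a \<noteq> 0"
    and eq: "scal a * Y ^ 2 = scal b * ham_Disc (ham_Disc Y)"
  shows "\<exists>c d. Y = scal d + scal c * E4"
proof -
  define W where "W = weight_hom Y"
  obtain h where h: "Y = [:h:]" using Y by (auto simp: modular_forms_def)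
  have "weight_hom (scal a * Y ^ 2) = weight_hom (scal b * ham_Disc (ham_Disc Y))"
    using eq by simp
  \<comment> \<open>Two applications of \<open>ham_Disc\<close> give the factor E2^2, so comparing
    degrees in \<open>E2\<close> yields 2 deg W \<le> 2 + deg W.\<close>
  then have W: "scal a * W ^ 2 = scal b * E2 ^ 2 * ham_Disc (ham_Disc W)"
    by (simp add: weight_hom_simps weight_hom_ham_Disc W_def power2_eq_square mult.assoc)
  have deg: "degree W \<le> 2"
  proof (cases "W = 0")
    case False
    have "degree (scal a) = 0" "degree (scal b) = 0" "degree (E2 ^ 2) = 2" "scal a \<noteq> 0"
      using \<open>a \<noteq> 0\<close> by (simp_all add: scal_def E2_def degree_power_eq)
    then have "degree (scal a * W ^ 2) = 2 * degree W"
      using False by (simp add: degree_mult_eq degree_power_eq)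
    moreover have "degree (scal b * E2 ^ 2 * ham_Disc (ham_Disc W)) \<le> 2 + degree W"
    proof -
      have "degree (scal b * E2 ^ 2 * ham_Disc (ham_Disc W)) \<le> degree (scal b * E2 ^ 2) + degree (ham_Disc (ham_Disc W))"
        by (rule degree_mult_le)
      also have "\<dots> \<le> (degree (scal b) + degree (E2 ^ 2)) + degree W"
        by (intro add_mono degree_mult_le order.trans[OF degree_ham_Disc_le degree_ham_Disc_le])
      finally show ?thesis using \<open>degree (scal b) = 0\<close> \<open>degree (E2 ^ 2) = 2\<close> by simp
    qed
    ultimately show ?thesis unfolding W by simp
  qed simp
  \<comment> \<open>\<open>weight_hom\<close> puts the monomial E4^i E6^j in degree 2 i + 3 j; as
    this is at most 2, only 1 and \<open>E4\<close> remain.\<close>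
  have zero: "coeff (coeff h i) j = 0" if "2 * i + 3 * j > 2" for i j
  proof -
    have "coeff W (2 * i + 3 * j) = 0" using deg that by (intro coeff_eq_0) simp
    then show ?thesis using qcoeff_weight_hom[of h "2 * i + 3 * j" i j] by (simp add: W_def h)
  qed
  have "h = [:[:coeff (coeff h 0) 0:], [:coeff (coeff h 1) 0:]:]"
  proof (intro poly_eqI)
    fix i j :: nat
    have "(i = 0 \<and> j = 0) \<or> (i = 1 \<and> j = 0) \<or> 2 * i + 3 * j > 2" by presburger
    then consider "i = 0" "j = 0" | "i = 1" "j = 0" | "2 * i + 3 * j > 2" by blast
    then show "coeff (coeff h i) j = coeff (coeff [:[:coeff (coeff h 0) 0:], [:coeff (coeff h 1) 0:]:] i) j"
      by cases (use zero[of i j] in \<open>auto simp: coeff_pCons split: nat.splits\<close>)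
  qed
  then have "Y = scal (coeff (coeff h 0) 0) + scal (coeff (coeff h 1) 0) * E4"
    by (simp add: h scal_def E4_def)
  then show ?thesis by blast
qed

text \<open>Write \<open>X\<close> for the image of \<open>E2\<close>. Every image is a polynomial in \<open>X\<close> with modular coefficients, so
  degrees in \<open>E2\<close> are multiples of \<open>degree X\<close>. As \<open>E2\<close> itself is an image, \<open>degree X = 1\<close> and the
  leading coefficient of \<open>X\<close> is a unit.\<close>

lemma modular_automorphism_E2:
  assumes iso: "algebra_iso \<phi>" and mod: "\<phi> ` modular_forms \<subseteq> modular_forms"
  shows "\<exists>c r. c \<noteq> 0 \<and> r \<in> modular_forms \<and> \<phi> E2 = r + scal c * E2"
proof -
  have bij: "bij \<phi>" and add: "\<And>f g. \<phi> (f + g) = \<phi> f + \<phi> g" and mult: "\<And>f g. \<phi> (f * g) = \<phi> f * \<phi> g"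
    and sc: "\<And>c. \<phi> (scal c) = scal c"
    using iso by (simp_all add: algebra_iso_def)
  define X where "X = \<phi> E2"
  \<comment> \<open>The restriction of \<phi> to modular forms, read on coefficients.\<close>
  define \<psi> where "\<psi> h = coeff (\<phi> [:h:]) 0" for h
  have \<psi>: "\<phi> [:h:] = [:\<psi> h:]" for h
  proof -
    have "\<phi> [:h:] \<in> modular_forms" using mod by (auto simp: modular_forms_def)
    then show ?thesis by (auto simp: modular_forms_def \<psi>_def)
  qed
  have z: "\<phi> 0 = 0" using sc[of 0] by (simp add: scal_simps)
  then have \<psi>0: "\<psi> 0 = 0" by (simp add: \<psi>_def)
  have comp: "\<phi> P = pcompose (map_poly \<psi> P) X" for P
  proof (induction P)
    case (pCons h P)
    have "pCons h P = [:h:] + E2 * P" by (simp add: E2_def)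
    then have "\<phi> (pCons h P) = [:\<psi> h:] + X * \<phi> P" by (simp only: add mult \<psi> X_def)
    then show ?case by (simp add: pCons map_poly_pCons \<psi>0 pcompose_pCons)
  qed (simp add: z)
  obtain P where P: "\<phi> P = E2" using bij by (metis bij_pointE)
  let ?Q = "map_poly \<psi> P"
  have "degree ?Q * degree X = 1"
    using arg_cong[OF P[unfolded comp], of degree] by (simp add: degree_pcompose E2_def)
  then have dX: "degree X = 1" and dQ: "degree ?Q = 1" by simp_all
  have "lead_coeff (pcompose ?Q X) = lead_coeff ?Q * lead_coeff X ^ degree ?Q"
    by (rule lead_coeff_comp) (use dX in simp)
  then have "lead_coeff ?Q * lead_coeff X = 1"
    using P[unfolded comp] dQ by (simp add: E2_def)
  then have "lead_coeff X dvd 1" by (metis dvd_triv_right)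
  then obtain c where c: "lead_coeff X = [:[:c:]:]" "c \<noteq> 0"
    by (auto simp: is_unit_poly_iff dvd_field_iff)
  have "X = [:coeff X 0:] + scal c * E2"
  proof (rule poly_eqI)
    fix n :: nat
    consider "n = 0" | "n = 1" | "n > 1" by linarith
    then show "coeff X n = coeff ([:coeff X 0:] + scal c * E2) n"
    proof cases
      case 2
      then show ?thesis using c dX by (simp add: scal_def E2_def)
    next
      case 3
      then show ?thesis using dX by (simp add: scal_def E2_def coeff_eq_0 coeff_pCons split: nat.splits)
    qed (simp add: scal_def E2_def)
  qed
  then show ?thesis using c(2) unfolding X_def modular_forms_def by blast
qed

lemma poisson_modular_isomorphic_imp_eq:
  assumes "poisson_modular_isomorphic (br \<alpha>) (br \<alpha>')"
  shows "\<alpha> = \<alpha>'"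
proof -
  obtain \<phi> where iso: "algebra_iso \<phi>" and mod: "\<phi> ` modular_forms \<subseteq> modular_forms"
    and br: "\<And>f g. \<phi> (br \<alpha> f g) = br \<alpha>' (\<phi> f) (\<phi> g)"
    using assms by (auto simp: poisson_modular_isomorphic_def poisson_iso_def)
  have bij: "bij \<phi>" and add: "\<And>f g. \<phi> (f + g) = \<phi> f + \<phi> g" and mult: "\<And>f g. \<phi> (f * g) = \<phi> f * \<phi> g"
    and sc: "\<And>c. \<phi> (scal c) = scal c"
    using iso by (simp_all add: algebra_iso_def)
  have z: "\<phi> 0 = 0" using sc[of 0] by (simp add: scal_simps)
  have inj: "\<phi> f \<noteq> 0" if "f \<noteq> 0" for f
    using bij that z by (metis bij_is_inj injD)
  have num: "\<phi> (numeral n) = numeral n" for n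
    using sc[of "numeral n"] by (simp add: scal_numeral)
  have neg: "\<phi> (- f) = - \<phi> f" for f
    using sc[of "- 1"] mult[of "scal (- 1)" f] by (simp add: scal_simps)
  define Y Z where "Y = \<phi> E4" and "Z = \<phi> E6"
  have YZ: "d_E2 Y = 0" "d_E2 Z = 0" and memY: "Y \<in> modular_forms"
    using mod by (auto simp: Y_def Z_def modular_forms_iff image_subset_iff)
  have Y0: "Y \<noteq> 0" and Z0: "Z \<noteq> 0"
    unfolding Y_def Z_def by (rule inj, simp add: E4_def E6_def)+
  have dD: "Disc \<noteq> 0"
  proof
    assume "Disc = 0"
    then have "E6 = 0" using d_Disc(3) by simp
    then show False by (simp add: E6_def)
  qed
  obtain c r where c: "c \<noteq> 0" and r: "d_E2 r = 0" and X: "\<phi> E2 = r + scal c * E2"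
    using modular_automorphism_E2[OF iso mod] by (auto simp: modular_forms_iff)
  \<comment> \<open>Apply \<phi> to the bracket of \<open>E2\<close> with \<open>f\<close> and
    compare the coefficients of \<open>E2\<close>: the term with factor r and the Jacobian term have
    degree 0 in \<open>E2\<close> and drop out.\<close>
  have key: "scal \<alpha> * \<phi> (ham_Disc f) = scal \<alpha>' * ham_Disc (\<phi> f)" if f: "d_E2 f = 0" for f
  proof -
    have ham: "d_E2 (ham_Disc g) = 0" if "d_E2 g = 0" for g
      using that by (simp add: ham_Disc_def d_commute power2_eq_square)
    have "d_E2 (\<phi> f) = 0" "d_E2 (\<phi> (ham_Disc f)) = 0"
      using f ham[OF f] mod by (auto simp: modular_forms_iff image_subset_iff)
    note F = this ham[OF this(1)]
    have "scal (\<alpha> / 2) * (r + scal c * E2) * \<phi> (ham_Disc f)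
        = - 2 * Disc * modular_jacobian r (\<phi> f) + scal (\<alpha>' / 2) * E2 * (scal c * ham_Disc (\<phi> f))"
      using br[of E2 f] unfolding X
      by (simp add: br_def modular_jacobian_def f F r mult sc X)
    from arg_cong[OF this, of d_E2]
    have "scal (\<alpha> / 2) * scal c * \<phi> (ham_Disc f) = scal (\<alpha>' / 2) * scal c * ham_Disc (\<phi> f)"
      by (simp add: modular_jacobian_def F r d_commute mult.assoc)
    then have "scal c * (scal (\<alpha> / 2) * \<phi> (ham_Disc f)) = scal c * (scal (\<alpha>' / 2) * ham_Disc (\<phi> f))"
      by (simp only: mult_ac)
    moreover have "scal c \<noteq> 0" using c by (simp add: scal_def)
    ultimately have "scal (\<alpha> / 2) * \<phi> (ham_Disc f) = scal (\<alpha>' / 2) * ham_Disc (\<phi> f)" by simp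
    then show ?thesis by (simp add: scal_half(1)[of \<alpha>] scal_half(1)[of \<alpha>'] mult.assoc)
  qed
  have hY: "scal \<alpha> * (2 * Z) = scal \<alpha>' * ham_Disc Y"
    using key[of E4] by (simp add: mult num Y_def Z_def)
  have hZ: "scal \<alpha> * (3 * Y ^ 2) = scal \<alpha>' * ham_Disc Z"
    using key[of E6] by (simp add: mult num power2_eq_square Y_def Z_def)
  \<comment> \<open>The relation for (E4, E6) says that the image of \<open>Disc\<close> is
    \<open>Disc\<close> times the Jacobian of Y and Z.\<close>
  have "\<phi> (br \<alpha> E4 E6) = - 2 * (Y ^ 3 - Z ^ 2)"
    by (simp add: br_def modular_jacobian_def Disc_def diff_conv_add_uminus add mult neg num power2_eq_square
          power3_eq_cube Y_def Z_def del: add_uminus_conv_diff)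
  moreover have "br \<alpha>' Y Z = - 2 * (Disc * modular_jacobian Y Z)"
    by (simp add: br_def YZ)
  ultimately have "- 2 * (Y ^ 3 - Z ^ 2) = - 2 * (Disc * modular_jacobian Y Z)"
    using br[of E4 E6] unfolding Y_def Z_def by (simp only:)
  then have cusp: "Y ^ 3 - Z ^ 2 = Disc * modular_jacobian Y Z"
    by (simp only: mult_cancel_left neg_equal_0_iff_equal zero_neq_numeral[symmetric] simp_thms)
  have cusp0: "Y ^ 3 - Z ^ 2 \<noteq> 0"
    using inj[OF dD] by (simp add: Disc_def diff_conv_add_uminus add mult neg power2_eq_square
          power3_eq_cube Y_def Z_def del: add_uminus_conv_diff)
  consider "\<alpha> = 0" "\<alpha>' = 0" | "\<alpha> = 0" "\<alpha>' \<noteq> 0" | "\<alpha> \<noteq> 0" "\<alpha>' = 0" | "\<alpha> \<noteq> 0" "\<alpha>' \<noteq> 0" by blast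
  then show ?thesis
  proof cases
    \<comment> \<open>\<open>ham_Disc\<close> would annihilate both Y and Z, so their Jacobian would
      vanish and the image of \<open>Disc\<close> would be 0.\<close>
    case 2
    then have "scal \<alpha>' \<noteq> 0" by (simp add: scal_def)
    with 2 hY hZ have "ham_Disc Y = 0" "ham_Disc Z = 0" by (simp_all add: scal_simps)
    then have "d_E6 Z * ham_Disc Y - d_E6 Y * ham_Disc Z = 0" by simp
    then have "2 * E6 * modular_jacobian Y Z = 0"
      by (simp add: ham_Disc_def modular_jacobian_def algebra_simps)
    then have "modular_jacobian Y Z = 0" by (simp add: E6_def)
    then show ?thesis using cusp cusp0 by simp
  next
    case 3
    then have "scal \<alpha> \<noteq> 0" by (simp add: scal_def)
    then show ?thesis using hY 3 Z0 by (simp add: scal_simps)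
  next
    case 4
    \<comment> \<open>Combining the two intertwining relations eliminates Z and leaves the quadratic
      equation for Y.\<close>
    have "scal (6 * \<alpha> ^ 2) * Y ^ 2 = 2 * scal \<alpha> * (scal \<alpha> * (3 * Y ^ 2))"
      by (simp add: scal_simps scal_numeral power2_eq_square mult_ac)
    also have "\<dots> = 2 * scal \<alpha> * (scal \<alpha>' * ham_Disc Z)" unfolding hZ ..
    also have "\<dots> = scal \<alpha>' * ham_Disc (scal \<alpha> * (2 * Z))"
      using ham_Disc_simps(3)[of 2] by (simp add: scal_numeral mult_ac)
    also have "\<dots> = scal (\<alpha>' ^ 2) * ham_Disc (ham_Disc Y)"
      unfolding hY by (simp add: scal_simps power2_eq_square mult_ac)
    finally have quad: "scal (6 * \<alpha> ^ 2) * Y ^ 2 = scal (\<alpha>' ^ 2) * ham_Disc (ham_Disc Y)" .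
    obtain c d where cd: "Y = scal d + scal c * E4"
      using ham_Disc_quadratic_solution[OF memY _ quad] 4 by auto
    \<comment> \<open>Evaluation at E2 = 0, E4 = y, E6 = 0, where \<open>Disc\<close> becomes y^3; y
      = 0 will kill d and y = 1 will relate c to the parameters.\<close>
    define ev where "ev y f = poly (poly (poly f 0) [:y:]) 0" for y and f :: qmod
    have ev: "ev y (f + g) = ev y f + ev y g" "ev y (f - g) = ev y f - ev y g" "ev y (f * g) = ev y f * ev y g"
       "ev y (f ^ n) = ev y f ^ n" "ev y (scal a) = a" "ev y (numeral m) = numeral m"
       "ev y E4 = y" "ev y E6 = 0" "ev y Disc = y ^ 3" for y f g n a m
      by (simp_all add: ev_def scal_def E4_def E6_def Disc_def)
    have h2: "ham_Disc (ham_Disc Y) = 6 * scal c * E4 ^ 2"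
      using ham_Disc_simps(3)[of 2] unfolding cd by (simp add: scal_numeral mult_ac)
    have e: "6 * \<alpha> ^ 2 * (d + c * y) ^ 2 = \<alpha>' ^ 2 * (6 * c * y ^ 2)" for y
      using arg_cong[OF quad, of "ev y"] unfolding h2 unfolding cd by (simp only: ev)
    have d: "d = 0" using e[of 0] 4 by simp
    then have c0: "c \<noteq> 0" using Y0 cd by (auto simp: scal_simps)
    have c1: "\<alpha> ^ 2 * c = \<alpha>' ^ 2" using e[of 1] d c0 by (simp add: power2_eq_square mult.assoc)
    have Y: "Y = scal c * E4" using cd d by (simp add: scal_simps)
    have "2 * (scal \<alpha> * Z) = 2 * (scal (\<alpha>' * c) * E6)"
      using hY unfolding Y by (simp add: scal_simps mult_ac)
    then have "scal \<alpha> * Z = scal (\<alpha>' * c) * E6" by simp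
    then have "scal (1 / \<alpha>) * (scal \<alpha> * Z) = scal (1 / \<alpha>) * (scal (\<alpha>' * c) * E6)" by simp
    then have Z: "Z = scal (\<alpha>' * c / \<alpha>) * E6"
      using 4 by (simp add: mult.assoc[symmetric] scal_simps(4)[symmetric] scal_simps(2))
    have "modular_jacobian Y Z = scal c * scal (\<alpha>' * c / \<alpha>)"
      unfolding Y Z by (simp add: modular_jacobian_def)
    \<comment> \<open>The left-hand side gives c^3 and the right-hand side c^2 \<alpha>' / \<alpha>,
      so c = \<alpha>' / \<alpha>, to be compared with \<alpha>^2 c = \<alpha>'^2.\<close>
    from arg_cong[OF cusp[unfolded this, unfolded Y Z], of "ev 1"]
    have "c ^ 3 = c * (\<alpha>' * c / \<alpha>)" by (simp only: ev) simp
    then have "(c * c) * c = (c * c) * (\<alpha>' / \<alpha>)" by (simp add: power3_eq_cube mult_ac)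
    then have "c = \<alpha>' / \<alpha>" using c0 by (simp only: mult_cancel_left mult_eq_0_iff simp_thms)
    then have "\<alpha>' * \<alpha> = \<alpha>' * \<alpha>'" using c1 4 by (simp add: power2_eq_square)
    then show ?thesis using 4 by simp
  qed simp
qed

lemma poisson_modular_isomorphic_br: "poisson_modular_isomorphic (br \<alpha>) (br \<alpha>') \<longleftrightarrow> \<alpha> = \<alpha>'"
proof
  assume "\<alpha> = \<alpha>'"
  then have "poisson_iso (br \<alpha>) (br \<alpha>') id \<and> id ` modular_forms \<subseteq> modular_forms"
    by (simp add: poisson_iso_def algebra_iso_def)
  then show "poisson_modular_isomorphic (br \<alpha>) (br \<alpha>')"
    unfolding poisson_modular_isomorphic_def by blast
qed (rule poisson_modular_isomorphic_imp_eq)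

section \<open>The classification\<close>

lemma poisson_center_br_irrational:
  assumes "\<alpha> \<notin> \<rat>"
  shows "poisson_center (br \<alpha>) = range scal"
proof (rule poisson_center_br_trivial)
  fix k n :: nat assume "k > 0"
  show "\<alpha> * of_nat k \<noteq> 4 * of_nat n"
  proof
    assume "\<alpha> * of_nat k = 4 * of_nat n"
    then have "\<alpha> = 4 * of_nat n / of_nat k" using \<open>k > 0\<close> by (simp add: field_simps)
    moreover have "4 * of_nat n / of_nat k \<in> (\<rat> :: complex set)" by simp
    ultimately show False using assms by simp
  qed
qed

text \<open>Writes \<alpha> as 4 P / Q in lowest terms according to the power of 2 in p: (P, Q) is
  (p, 4 q), (u, 2 q) or (v, q). For p < 0 the sign excludes \<alpha> k = 4 n with k > 0.\<close>

lemma poisson_center_br_rational: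
  fixes p :: int and q :: nat
  assumes "q \<noteq> 0" and cop: "coprime p (int q)" and \<alpha>: "\<alpha> = of_int p / of_nat q"
  shows "p < 0 \<Longrightarrow> poisson_center (br \<alpha>) = range scal"
    and "p \<ge> 1 \<Longrightarrow> odd p \<Longrightarrow> poisson_center (br \<alpha>) = gen_subalgebra (Disc ^ nat p * E2 ^ (4 * q))"
    and "odd u \<Longrightarrow> p = 2 * int u \<Longrightarrow> poisson_center (br \<alpha>) = gen_subalgebra (Disc ^ u * E2 ^ (2 * q))"
    and "p = 4 * int v \<Longrightarrow> poisson_center (br \<alpha>) = gen_subalgebra (Disc ^ v * E2 ^ q)"
proof -
  have \<alpha>q: "\<alpha> * of_nat q = of_int p" using \<alpha> \<open>q \<noteq> 0\<close> by simp
  show "poisson_center (br \<alpha>) = range scal" if "p < 0"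
  proof (rule poisson_center_br_trivial)
    fix k n :: nat assume "k > 0"
    show "\<alpha> * of_nat k \<noteq> 4 * of_nat n"
    proof
      assume "\<alpha> * of_nat k = 4 * of_nat n"
      then have "(\<alpha> * of_nat q) * of_nat k = 4 * of_nat n * of_nat q" by (simp add: mult_ac)
      then have "(of_int (p * int k) :: complex) = of_int (4 * int n * int q)" unfolding \<alpha>q by simp
      then have "p * int k = 4 * int n * int q" by (simp only: of_int_eq_iff)
      moreover have "p * int k < 0" using that \<open>k > 0\<close> by (simp add: mult_neg_pos)
      moreover have "4 * int n * int q \<ge> 0" by simp
      ultimately show False by linarith
    qed
  qed
  show "poisson_center (br \<alpha>) = gen_subalgebra (Disc ^ nat p * E2 ^ (4 * q))" if "p \<ge> 1" "odd p"
  proof (rule poisson_center_br)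
    define m where "m = nat p"
    have m: "p = int m" using that(1) by (simp add: m_def)
    have "odd m" using that(2) by (simp add: m)
    then have "coprime m (2 ^ 2)" by (simp only: coprime_power_right_iff coprime_right_2_iff_odd simp_thms)
    moreover have "coprime m q" using cop by (simp add: m)
    ultimately have "coprime m (2 ^ 2 * q)" by (simp only: coprime_mult_right_iff)
    then show "coprime (nat p) (4 * q)" by (simp add: m)
    show "\<alpha> * of_nat (4 * q) = 4 * of_nat (nat p)" using \<alpha>q by (simp add: m)
  qed (use \<open>q \<noteq> 0\<close> in simp)
  show "poisson_center (br \<alpha>) = gen_subalgebra (Disc ^ u * E2 ^ (2 * q))" if "odd u" "p = 2 * int u"
  proof (rule poisson_center_br)
    have "coprime (int u) (int q)" using cop that(2) by simp
    then have "coprime u q" by simp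
    moreover have "coprime u 2" using that(1) by (rule coprime_right_2_iff_odd[THEN iffD2])
    ultimately show "coprime u (2 * q)" by (simp only: coprime_mult_right_iff)
    show "\<alpha> * of_nat (2 * q) = 4 * of_nat u" using \<alpha>q that(2) by simp
  qed (use \<open>q \<noteq> 0\<close> in simp)
  show "poisson_center (br \<alpha>) = gen_subalgebra (Disc ^ v * E2 ^ q)" if "p = 4 * int v"
  proof (rule poisson_center_br)
    show "coprime v q" using cop that by simp
    show "\<alpha> * of_nat q = 4 * of_nat v" using \<alpha>q that by simp
  qed (use \<open>q \<noteq> 0\<close> in simp)
qed

text \<open>The family comes with uniqueness, so that all further clauses concern the bracket
  determined by the values on the generators.\<close>

theorem propositionB:
  shows "\<exists>br :: complex \<Rightarrow> qmod \<Rightarrow> qmod \<Rightarrow> qmod.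
    (\<forall>\<alpha>. admissible (br \<alpha>) \<and> has_generator_values \<alpha> (br \<alpha>) \<and>
         (\<forall>b. poisson_bracket b \<and> has_generator_values \<alpha> b \<longrightarrow> b = br \<alpha>)) \<and>
    (\<forall>\<alpha>. \<alpha> \<noteq> 4 \<longrightarrow> \<not> unimodular (br \<alpha>)) \<and>
    jacobian_of_potential (br 4) (- 2 * Disc * E2) \<and> unimodular (br 4) \<and>
    (\<forall>\<alpha> \<alpha>'. poisson_modular_isomorphic (br \<alpha>) (br \<alpha>') \<longleftrightarrow> \<alpha> = \<alpha>') \<and>
    (\<forall>\<alpha>. \<alpha> \<notin> \<rat> \<longrightarrow> poisson_center (br \<alpha>) = range scal) \<and>
    poisson_center (br 0) = gen_subalgebra E2 \<and>
    (\<forall>\<alpha> (p :: int) (q :: nat).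
       p \<noteq> 0 \<and> q \<noteq> 0 \<and> coprime p (int q) \<and> \<alpha> = of_int p / of_nat q \<longrightarrow>
         (p < 0 \<longrightarrow> poisson_center (br \<alpha>) = range scal) \<and>
         (p \<ge> 1 \<and> odd p \<longrightarrow>
            poisson_center (br \<alpha>) = gen_subalgebra (Disc ^ nat p * E2 ^ (4 * q))) \<and>
         (\<forall>u :: nat. u \<ge> 1 \<and> odd u \<and> p = 2 * int u \<longrightarrow>
            poisson_center (br \<alpha>) = gen_subalgebra (Disc ^ u * E2 ^ (2 * q))) \<and>
         (\<forall>v :: nat. v \<ge> 1 \<and> p = 4 * int v \<longrightarrow>
            poisson_center (br \<alpha>) = gen_subalgebra (Disc ^ v * E2 ^ q)))"
proof (rule exI[of _ br], intro conjI allI impI)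
  fix \<alpha> b assume "poisson_bracket b \<and> has_generator_values \<alpha> b"
  then show "b = br \<alpha>"
    using poisson_bracket_unique poisson_bracket_br has_generator_values_br by blast
next
  show "poisson_center (br 0) = gen_subalgebra E2"
    \<comment> \<open>The case \<alpha> = 0 is the fraction 0 / 1, with generator Disc^0
      E2^1.\<close>
    using poisson_center_br[of 0 1 0] by simp
next
  fix \<alpha> :: complex and p :: int and q :: nat
  assume "p \<noteq> 0 \<and> q \<noteq> 0 \<and> coprime p (int q) \<and> \<alpha> = of_int p / of_nat q"
  then have *: "q \<noteq> 0" "coprime p (int q)" "\<alpha> = of_int p / of_nat q" by blast+
  show "poisson_center (br \<alpha>) = range scal" if "p < 0"
    using poisson_center_br_rational(1)[OF *] that by blast
  show "poisson_center (br \<alpha>) = gen_subalgebra (Disc ^ nat p * E2 ^ (4 * q))" if "1 \<le> p \<and> odd p"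
    using poisson_center_br_rational(2)[OF *] that by blast
  show "poisson_center (br \<alpha>) = gen_subalgebra (Disc ^ u * E2 ^ (2 * q))"
    if "1 \<le> u \<and> odd u \<and> p = 2 * int u" for u
    using poisson_center_br_rational(3)[OF *] that by blast
  show "poisson_center (br \<alpha>) = gen_subalgebra (Disc ^ v * E2 ^ q)" if "1 \<le> v \<and> p = 4 * int v" for v
    using poisson_center_br_rational(4)[OF *] that by blast
qed (rule admissible_br has_generator_values_br not_unimodular_br jacobian_of_potential_br_4
      unimodular_br_4 poisson_modular_isomorphic_br poisson_center_br_irrational, assumption?)+

end
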